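(* Let $\mathcal G=(\Sigma,\mathcal N,\mathcal R)$ be an unambiguous and strongly connected regular tree grammar such that $\#\mathcal L(\mathcal G)=\infty$, and let $(S_n)_{n\in\mathbb N}$ be a family of linear contexts in $\mathcal S(\mathcal G)$ such that $|S_n|=O(n)$. Then there exists a real constant $p>0$ such that for any $N\in\mathcal N$ the following equation holds: $$\operatorname*{lim\,def}_{n\to\infty}\frac{\#\{T\in\mathcal L_n(\mathcal G,N)\mid S_{\lceil p\log n\rceil}\preceq T\}}{\#\mathcal L_n(\mathcal G,N)}=1.$$
   Context: $\#A$ is the cardinality of $A$; $\log$ is the binary logarithm. Trees and contexts: a ranked alphabet $\Sigma$ is a map from a finite set $\mathrm{Dom}(\Sigma)$ of terminals to $\mathbb N$; $\Sigma(a)$ is the rank of $a$. $\Sigma$-trees are built as $a(T_1,\dots,T_{\Sigma(a)})$. Contexts over $\Sigma$: $C::=[\,]\mid a(C_1,\dots,C_{\Sigma(a)})$. $\mathrm{hn}(C)$ is the number of holes $[\,]$ in $C$; $C$ is a $k$-context if $\mathrm{hn}(C)=k$, and linear if $\mathrm{hn}(C)=1$. Size: $|[\,]|=0$, $|a(C_1,\dots,C_{\Sigma(a)})|=1+\sum_i|C_i|$. Trees are $0$-contexts. $C[C_1,\dots,C_{\mathrm{hn}(C)}]$ replaces the $i$-th hole (left to right) of $C$ by $C_i$; $C[C']_i$ replaces the $i$-th hole of $C$ by $C'$. $C\preceq C'$ (subcontext) iff there are $C_0,C_1,\dots,C_{\mathrm{hn}(C)}$ and $1\le i\le\mathrm{hn}(C_0)$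 with $C'=C_0[C[C_1,\dots,C_{\mathrm{hn}(C)}]]_i$. Grammars: a regular tree grammar is $\mathcal G=(\Sigma,\mathcal N,\mathcal R)$ with $\Sigma$ a ranked alphabet, $\mathcal N$ a finite set of nonterminals, $\mathcal R$ a finite set of rules $N\to C[N_1,\dots,N_{\mathrm{hn}(C)}]$ with $C$ a context over $\Sigma$ and $N,N_i\in\mathcal N$. Nonterminals are treated as rank-$0$ symbols; $\to_{\mathcal G}$ on $(\Sigma\cup\mathcal N)$-trees rewrites one nonterminal occurrence by a rule, and $\to^*_{\mathcal G}$ is its reflexive transitive closure. $\mathcal L(\mathcal G,N)$ is the set of $\Sigma$-trees $T$ with $N\to^*_{\mathcal G}T$; $\mathcal L_n(\mathcal G,N)$ those of size $n$; $\mathcal L(\mathcal G)=\bigcup_{N\in\mathcal N}\mathcal L(\mathcal G,N)$. $\mathcal L(\mathcal G,N\Rightarrow N')$ is the set of linear contexts $S$ over $\Sigma$ with $N'\to^*_{\mathcal G}S[N]$; $\mathcal S(\mathcal G)=\bigcup_{N,N'\in\mathcal N}\mathcal L(\mathcal G,N\Rightarrow N')$. $\mathcal G$ is strongly connected if $\mathcal L(\mathcal G,N'\Rightarrow N)\neq\emptyset$ for all $N,N'\in\mathcal N$. $\mathcal G$ is unambiguous if for every $N\in\mathcal N$ and every $\Sigma$-tree $T$ there is at most one leftmost rewriting sequence from $N$ to $T$ (each step rewriting the leftmost nonterminal occurrence). For sequences $(a_n),(b_n)$ with $a_n\ne0$ for infinitely many $n$, $\operatorname{lim\,def}_{n\to\infty}b_n/a_n$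 denotes $\lim_{j\to\infty}b_{n_j}/a_{n_j}$, where $n_0<n_1<\cdots$ enumerates $\{n\mid a_n\neq0\}$. *)

theory Defs
  imports Complex_Main "HOL-Library.Infinite_Set" "HOL-Library.Landau_Symbols"
begin

section \<open>Trees and contexts\<close>

text \<open>A ranked alphabet is a partial function \<open>\<Sigma> :: 'a \<rightharpoonup> nat\<close> with finite domain. The datatype
  contains unranked terms; \<open>contexts \<Sigma>\<close> carves out those respecting the ranks of \<open>\<Sigma>\<close>.\<close>

datatype 'a ctxt = Hole | Node 'a "'a ctxt list"

primrec is_context :: "('a \<rightharpoonup> nat) \<Rightarrow> 'a ctxt \<Rightarrow> bool" where
  "is_context \<Sigma> Hole \<longleftrightarrow> True"
| "is_context \<Sigma> (Node a Cs) \<longleftrightarrow>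
     \<Sigma> a = Some (length Cs) \<and> list_all (is_context \<Sigma>) Cs"

definition contexts :: "('a \<rightharpoonup> nat) \<Rightarrow> 'a ctxt set" where
  "contexts \<Sigma> = {C. is_context \<Sigma> C}"

primrec hn :: "'a ctxt \<Rightarrow> nat" where
  "hn Hole = 1"
| "hn (Node a Cs) = sum_list (map hn Cs)"

primrec csize :: "'a ctxt \<Rightarrow> nat" where
  "csize Hole = 0"
| "csize (Node a Cs) = 1 + sum_list (map csize Cs)"

definition trees :: "('a \<rightharpoonup> nat) \<Rightarrow> 'a ctxt set" where
  "trees \<Sigma> = {T \<in> contexts \<Sigma>. hn T = 0}"

definition linear_contexts :: "('a \<rightharpoonup> nat) \<Rightarrow> 'a ctxt set" where
  "linear_contexts \<Sigma> = {C \<in> contexts \<Sigma>. hn C = 1}"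

text \<open>\<open>fill C [C\<^sub>1, \<dots>, C\<^sub>k]\<close> is \<open>C[C\<^sub>1, \<dots>, C\<^sub>k]\<close>; it is only meaningful for \<open>k = hn C\<close>.\<close>

fun fill :: "'a ctxt \<Rightarrow> 'a ctxt list \<Rightarrow> 'a ctxt"
  and fill_list :: "'a ctxt list \<Rightarrow> 'a ctxt list \<Rightarrow> 'a ctxt list" where
  "fill Hole Ds = hd Ds"
| "fill (Node a Cs) Ds = Node a (fill_list Cs Ds)"
| "fill_list [] Ds = []"
| "fill_list (C # Cs) Ds = fill C (take (hn C) Ds) # fill_list Cs (drop (hn C) Ds)"

text \<open>\<open>fill_at C i D\<close> is \<open>C[D]\<^sub>i\<close>. Holes are numbered from 1, whereas list positions start at 0.\<close>

definition fill_at :: "'a ctxt \<Rightarrow> nat \<Rightarrow> 'a ctxt \<Rightarrow> 'a ctxt" where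
  "fill_at C i D = fill C ((replicate (hn C) Hole)[i - 1 := D])"

definition subcontext :: "('a \<rightharpoonup> nat) \<Rightarrow> 'a ctxt \<Rightarrow> 'a ctxt \<Rightarrow> bool" where
  "subcontext \<Sigma> C C' \<longleftrightarrow>
     (\<exists>C0 \<in> contexts \<Sigma>. \<exists>Cs i. set Cs \<subseteq> contexts \<Sigma> \<and> length Cs = hn C \<and>
        1 \<le> i \<and> i \<le> hn C0 \<and> C' = fill_at C0 i (fill C Cs))"

section \<open>Regular tree grammars\<close>

text \<open>A rule \<open>(N, C, [N\<^sub>1, \<dots>, N\<^sub>k])\<close> stands for \<open>N \<rightarrow> C[N\<^sub>1, \<dots>, N\<^sub>k]\<close>.\<close>

record ('a, 'n) grammar =
  terminals :: "'a \<rightharpoonup> nat"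
  nonterms :: "'n set"
  rules :: "('n \<times> 'a ctxt \<times> 'n list) set"

definition regular_tree_grammar :: "('a, 'n) grammar \<Rightarrow> bool" where
  "regular_tree_grammar G \<longleftrightarrow>
     finite (dom (terminals G)) \<and> finite (nonterms G) \<and> finite (rules G) \<and>
     (\<forall>(N, C, Ns) \<in> rules G. N \<in> nonterms G \<and> C \<in> contexts (terminals G) \<and>
        length Ns = hn C \<and> set Ns \<subseteq> nonterms G)"

text \<open>The disjoint union of terminals and nonterminals is modelled by the type \<open>'a + 'n\<close>:
  terminals are tagged with \<open>Inl\<close>, nonterminals with \<open>Inr\<close>.\<close>

abbreviation emb :: "'a ctxt \<Rightarrow> ('a + 'n) ctxt" where
  "emb \<equiv> map_ctxt Inl"

abbreviation NT :: "'n \<Rightarrow> ('a + 'n) ctxt" where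
  "NT N \<equiv> Node (Inr N) []"

text \<open>Ranks are not checked during rewriting: for a regular tree grammar, trees over terminals and
  nonterminals (the latter of rank 0) are rewritten to such trees only.\<close>

inductive step :: "('a, 'n) grammar \<Rightarrow> ('a + 'n) ctxt \<Rightarrow> ('a + 'n) ctxt \<Rightarrow> bool"
  for G where
  step_root: "(N, C, Ns) \<in> rules G \<Longrightarrow> step G (NT N) (fill (emb C) (map NT Ns))"
| step_child: "step G T T' \<Longrightarrow>
     step G (Node (Inl a) (Ts @ T # Us)) (Node (Inl a) (Ts @ T' # Us))"

text \<open>In a leftmost step no nonterminal occurs to the left of the rewritten one.\<close>

inductive leftmost_step :: "('a, 'n) grammar \<Rightarrow> ('a + 'n) ctxt \<Rightarrow> ('a + 'n) ctxt \<Rightarrow> bool"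
  for G where
  leftmost_root: "(N, C, Ns) \<in> rules G \<Longrightarrow> leftmost_step G (NT N) (fill (emb C) (map NT Ns))"
| leftmost_child: "leftmost_step G T T' \<Longrightarrow> \<forall>U \<in> set Ts. set_ctxt U \<inter> range Inr = {} \<Longrightarrow>
     leftmost_step G (Node (Inl a) (Ts @ T # Us)) (Node (Inl a) (Ts @ T' # Us))"

definition lang :: "('a, 'n) grammar \<Rightarrow> 'n \<Rightarrow> 'a ctxt set" where
  "lang G N = {T \<in> trees (terminals G). (step G)\<^sup>*\<^sup>* (NT N) (emb T)}"

definition lang_size :: "('a, 'n) grammar \<Rightarrow> nat \<Rightarrow> 'n \<Rightarrow> 'a ctxt set" where
  "lang_size G n N = {T \<in> lang G N. csize T = n}"

definition lang_all :: "('a, 'n) grammar \<Rightarrow> 'a ctxt set" where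
  "lang_all G = (\<Union>N \<in> nonterms G. lang G N)"

text \<open>\<open>ctxt_lang G N N'\<close> is \<open>L(G, N \<Rightarrow> N')\<close>; note that the derivation starts from \<open>N'\<close>.\<close>

definition ctxt_lang :: "('a, 'n) grammar \<Rightarrow> 'n \<Rightarrow> 'n \<Rightarrow> 'a ctxt set" where
  "ctxt_lang G N N' =
     {S \<in> linear_contexts (terminals G). (step G)\<^sup>*\<^sup>* (NT N') (fill (emb S) [NT N])}"

definition ctxt_lang_all :: "('a, 'n) grammar \<Rightarrow> 'a ctxt set" where
  "ctxt_lang_all G = (\<Union>N \<in> nonterms G. \<Union>N' \<in> nonterms G. ctxt_lang G N N')"

definition strongly_connected :: "('a, 'n) grammar \<Rightarrow> bool" where
  "strongly_connected G \<longleftrightarrow> (\<forall>N \<in> nonterms G. \<forall>N' \<in> nonterms G. ctxt_lang G N' N \<noteq> {})"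

text \<open>A rewriting sequence is the nonempty list of the trees it visits. For leftmost steps this list
  also determines the rules applied.\<close>

definition leftmost_seq ::
  "('a, 'n) grammar \<Rightarrow> ('a + 'n) ctxt \<Rightarrow> ('a + 'n) ctxt \<Rightarrow> ('a + 'n) ctxt list \<Rightarrow> bool" where
  "leftmost_seq G T T' ts \<longleftrightarrow>
     ts \<noteq> [] \<and> hd ts = T \<and> last ts = T' \<and> successively (leftmost_step G) ts"

definition unambiguous :: "('a, 'n) grammar \<Rightarrow> bool" where
  "unambiguous G \<longleftrightarrow>
     (\<forall>N \<in> nonterms G. \<forall>T \<in> trees (terminals G). \<forall>ts ts'.
        leftmost_seq G (NT N) (emb T) ts \<and> leftmost_seq G (NT N) (emb T) ts' \<longrightarrow> ts = ts')"

section \<open>Limits along the indices where the quotient is defined\<close>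

text \<open>\<open>has_limdef b a l\<close> states that the limit of \<open>b n / a n\<close>, taken along the increasing enumeration
  of \<open>{n. a n \<noteq> 0}\<close>, is well-formed (that set is infinite), exists, and equals \<open>l\<close>.\<close>

definition has_limdef :: "(nat \<Rightarrow> real) \<Rightarrow> (nat \<Rightarrow> real) \<Rightarrow> real \<Rightarrow> bool" where
  "has_limdef b a l \<longleftrightarrow>
     infinite {n. a n \<noteq> 0} \<and>
     (\<lambda>j. b (enumerate {n. a n \<noteq> 0} j) / a (enumerate {n. a n \<noteq> 0} j)) \<longlonglongrightarrow> l"

end

theory Submission
  imports Defs
begin

text \<open>By unambiguity, trees of the language correspond to derivation trees, and an occurrence of
  (a derivation of) \<open>S\<close> in a derivation makes \<open>S\<close> a subcontext of the tree. The number of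
  derivations without an occurrence is bounded by double counting. A pigeonhole argument on pairs
  (nonterminal, size modulo a common loop size) shows that every derivation of size \<open>n\<close> has at
  least \<open>n / O(|S|)\<close> nodes at which a loop \<open>L\<close> from a nonterminal to itself starts, with
  \<open>|L| = O(|S|)\<close>. Each such \<open>L\<close> can be replaced by a loop of exactly the same size in which \<open>S\<close>
  occurs. If \<open>S\<close> did not occur before, all its occurrences afterwards are near the replaced loop,
  so at most \<open>\<Theta> ^ |S|\<close> replacements lead to the same derivation. Hence the proportion of
  derivations without an occurrence is at most \<open>\<Theta> ^ (|S| + 1) / n\<close>, which tends to 0 when
  \<open>|S|\<close> is at most a small multiple of \<open>log n\<close>.\<close>

section \<open>Derivation trees and zippers\<close>

text \<open>Unambiguity does more than identify trees with derivations. Root and yield determine a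
  derivation, so there are at most exponentially many of size n; this limits the price of recording
  a removed loop to something exponential in its size. Finitely many derivations per size also
  exclude loops of weight 0. Rules without terminals are allowed, so depth is bounded by size only
  through this exclusion. A replacement has to keep the size, since only derivations of the same
  size n are compared. The residues modulo the common loop size \<open>a\<close> serve this purpose:
  a path through \<open>S\<close> taken \<open>a\<close> times has a size divisible by
  \<open>a\<close>, and loops of size \<open>a\<close> fill up what is missing. If |S| <= c * m with
  m about p * log n, the value p = 1 / (2 * c * log \<Theta>) turns the exponential loss into a
  multiple of sqrt n, against a gain of n. As \<Theta> depends on the grammar only, one p serves all
  nonterminals.\<close>

datatype 'r deriv = Der 'r "'r deriv list"

text \<open>A frame holds a rule and the subtrees left and right of the path. A zipper is thus a
  derivation with one hole; composition is list append, and the depth of the hole is the list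
  length.\<close>

type_synonym 'r zipper = "('r \<times> 'r deriv list \<times> 'r deriv list) list"

fun plug :: "'r zipper \<Rightarrow> 'r deriv \<Rightarrow> 'r deriv" where
  "plug [] t = t"
| "plug ((\<rho>, ls, rs) # Z) t = Der \<rho> (ls @ plug Z t # rs)"

lemma plug_append [simp]: "plug (Y @ Z) t = plug Y (plug Z t)"
  by (induction Y) auto

lemma plug_inject [simp]: "plug Z t = plug Z u \<longleftrightarrow> t = u"
  by (induction Z) auto

definition zpow :: "nat \<Rightarrow> 'r zipper \<Rightarrow> 'r zipper" where
  "zpow k Z = concat (replicate k Z)"

lemma zpow_simps [simp]: "zpow 0 Z = []" "zpow (Suc k) Z = Z @ zpow k Z"
  by (simp_all add: zpow_def)

lemma size_plug: "size t + length Z \<le> size (plug Z t)"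
  by (induction Z) auto

section \<open>Occurrences of zippers, and counting the nodes of a derivation\<close>

definition contains :: "'r zipper \<Rightarrow> 'r deriv \<Rightarrow> bool" where
  "contains Z t \<longleftrightarrow> (\<exists>E u. t = plug E (plug Z u))"

primrec ntops :: "('r deriv \<Rightarrow> bool) \<Rightarrow> 'r deriv \<Rightarrow> nat" where
  "ntops P (Der \<rho> ts) = (if P (Der \<rho> ts) then 1 else 0) + sum_list (map (ntops P) ts)"

lemma ntops_pos: "P t \<Longrightarrow> 1 \<le> ntops P t"
  by (cases t) auto

lemma ntops_plug: "ntops P t \<le> ntops P (plug Z t)"
  by (induction Z) auto

lemma ntops_plug_Cons: "P (plug (f # Z) t) \<Longrightarrow> Suc (ntops P t) \<le> ntops P (plug (f # Z) t)"
  using ntops_plug[of P t Z] by (cases f) auto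

lemma tops_Der:
  "{E. \<exists>u. Der \<rho> ts = plug E u \<and> P u} =
     (if P (Der \<rho> ts) then {[]} else {}) \<union>
     (\<Union>i<length ts. (\<lambda>E. (\<rho>, take i ts, drop (Suc i) ts) # E) ` {E. \<exists>u. ts ! i = plug E u \<and> P u})"
  (is "?L = ?A \<union> ?B")
proof (intro set_eqI iffI)
  fix E assume "E \<in> ?L"
  then obtain u where u: "Der \<rho> ts = plug E u" "P u" by blast
  show "E \<in> ?A \<union> ?B"
  proof (cases E)
    case Nil
    with u show ?thesis by auto
  next
    case (Cons f E')
    obtain \<rho>' ls rs where f: "f = (\<rho>', ls, rs)" by (cases f)
    from u Cons f have "\<rho>' = \<rho>" and ts: "ts = ls @ plug E' u # rs" by auto
    moreover from ts have "length ls < length ts" "ts ! length ls = plug E' u"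
      "take (length ls) ts = ls" "drop (Suc (length ls)) ts = rs" by auto
    ultimately have "E \<in> ?B"
      using u(2) Cons f by (intro UN_I[of "length ls"]) auto
    then show ?thesis by blast
  qed
next
  fix E assume "E \<in> ?A \<union> ?B"
  then consider "E = []" "P (Der \<rho> ts)" |
    i E' u where "i < length ts" "E = (\<rho>, take i ts, drop (Suc i) ts) # E'" "ts ! i = plug E' u" "P u"
    by (auto split: if_splits)
  then show "E \<in> ?L"
  proof cases
    case 1
    then show ?thesis by auto
  next
    case 2
    then have "Der \<rho> ts = plug E u" by (simp add: id_take_nth_drop[symmetric] flip: 2(3))
    with 2 show ?thesis by auto
  qed
qed

text \<open>A node is identified with the zipper above it. The recursive count thereby becomes the
  cardinality of a set, as double counting requires.\<close>

lemma finite_card_tops: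
  "finite {E. \<exists>u. D = plug E u \<and> P u} \<and> card {E. \<exists>u. D = plug E u \<and> P u} = ntops P D"
proof (induction D)
  case (Der \<rho> ts)
  define T where "T t = {E. \<exists>u. t = plug E u \<and> P u}" for t
  define f where "f i E = (\<rho>, take i ts, drop (Suc i) ts) # E" for i E
  define B where "B = (\<Union>i<length ts. f i ` T (ts ! i))"
  define I where "I = (if P (Der \<rho> ts) then {[]} else {} :: 'a zipper set)"
  have T: "T (Der \<rho> ts) = I \<union> B"
    unfolding T_def f_def B_def I_def by (rule tops_Der)
  have IH: "finite (T (ts ! i))" "card (T (ts ! i)) = ntops P (ts ! i)" if "i < length ts" for i
    using Der[OF nth_mem[OF that]] by (simp_all add: T_def)
  have finB: "finite B" unfolding B_def using IH by (intro finite_UN_I finite_imageI) auto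
  have inj: "inj_on (f i) X" for i X by (auto simp: inj_on_def f_def)
  have "card B = (\<Sum>i<length ts. card (f i ` T (ts ! i)))"
    unfolding B_def
  proof (rule card_UN_disjoint)
    show "\<forall>i\<in>{..<length ts}. \<forall>j\<in>{..<length ts}. i \<noteq> j \<longrightarrow> f i ` T (ts ! i) \<inter> f j ` T (ts ! j) = {}"
    proof (intro ballI impI)
      fix i j assume "i \<in> {..<length ts}" "j \<in> {..<length ts}" "i \<noteq> j"
      then have "length (take i ts) \<noteq> length (take j ts)" by simp
      then have "take i ts \<noteq> take j ts" by metis
      then have "f i E \<noteq> f j E'" for E E' by (simp add: f_def)
      then show "f i ` T (ts ! i) \<inter> f j ` T (ts ! j) = {}" by blast
    qed
  qed (use IH in auto)
  also have "\<dots> = (\<Sum>i<length ts. ntops P (ts ! i))"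
    by (intro sum.cong) (auto simp: card_image[OF inj] IH)
  also have "\<dots> = sum_list (map (ntops P) ts)"
    by (simp add: sum_list_sum_nth atLeast0LessThan)
  finally have cardB: "card B = sum_list (map (ntops P) ts)" .
  have "[] \<notin> B" by (auto simp: B_def f_def)
  then have "card (I \<union> B) = ntops P (Der \<rho> ts)"
    using finB cardB by (simp add: I_def)
  moreover have "finite (I \<union> B)" using finB by (simp add: I_def)
  ultimately show ?case unfolding T[symmetric] T_def by blast
qed

text \<open>The combinatorial part sees of a rule only its left-hand side, the nonterminals it calls
  and a weight, which for grammars is the number of its terminals. Contexts return in
  \<open>tree_grammar\<close>.\<close>

locale weighted_rules =
  fixes R :: "'r set" and lhs :: "'r \<Rightarrow> 'n" and args :: "'r \<Rightarrow> 'n list"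
    and wt :: "'r \<Rightarrow> nat" and V :: "'n set"
begin

primrec root :: "'r deriv \<Rightarrow> 'n" where
  "root (Der \<rho> ts) = lhs \<rho>"

primrec valid :: "'r deriv \<Rightarrow> bool" where
  "valid (Der \<rho> ts) \<longleftrightarrow> \<rho> \<in> R \<and> map root ts = args \<rho> \<and> list_all valid ts"

primrec dsize :: "'r deriv \<Rightarrow> nat" where
  "dsize (Der \<rho> ts) = wt \<rho> + sum_list (map dsize ts)"

definition fsize :: "'r \<times> 'r deriv list \<times> 'r deriv list \<Rightarrow> nat" where
  "fsize = (\<lambda>(\<rho>, ls, rs). wt \<rho> + sum_list (map dsize ls) + sum_list (map dsize rs))"

definition zsize :: "'r zipper \<Rightarrow> nat" where
  "zsize Z = sum_list (map fsize Z)"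

lemma zsize_simps [simp]:
  "zsize [] = 0" "zsize (f # Z) = fsize f + zsize Z" "zsize (Y @ Z) = zsize Y + zsize Z"
  by (simp_all add: zsize_def)

lemma zsize_zpow [simp]: "zsize (zpow k Z) = k * zsize Z"
  by (induction k) auto

lemma dsize_plug: "dsize (plug Z t) = zsize Z + dsize t"
  by (induction Z) (auto simp: fsize_def)

lemma valid_plugD: "valid (plug Z t) \<Longrightarrow> valid t"
  by (induction Z) auto

lemma valid_plug_exchange:
  "valid (plug Z t) \<Longrightarrow> valid u \<Longrightarrow> root u = root t \<Longrightarrow>
     valid (plug Z u) \<and> root (plug Z u) = root (plug Z t)"
  by (induction Z) auto

text \<open>If no derivation has root \<open>N\<close> then \<open>zok M N Z\<close> holds vacuously; lemma \<open>inhabited\<close>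
  below excludes this case.\<close>

definition zok :: "'n \<Rightarrow> 'n \<Rightarrow> 'r zipper \<Rightarrow> bool" where
  "zok M N Z \<longleftrightarrow> (\<forall>t. valid t \<and> root t = N \<longrightarrow> valid (plug Z t) \<and> root (plug Z t) = M)"

lemma zokD: "zok M N Z \<Longrightarrow> valid t \<Longrightarrow> root t = N \<Longrightarrow> valid (plug Z t)"
    "zok M N Z \<Longrightarrow> valid t \<Longrightarrow> root t = N \<Longrightarrow> root (plug Z t) = M"
  by (simp_all add: zok_def)

lemma zok_plug: "valid (plug Z t) \<Longrightarrow> zok (root (plug Z t)) (root t) Z"
  unfolding zok_def using valid_plug_exchange by blast

lemma zok_Nil: "zok M M []" by (simp add: zok_def)

lemma zok_append: "zok L M Y \<Longrightarrow> zok M N Z \<Longrightarrow> zok L N (Y @ Z)"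
  by (simp add: zok_def)

lemma zok_zpow: "zok M M Z \<Longrightarrow> zok M M (zpow k Z)"
  by (induction k) (auto intro: zok_Nil zok_append)

text \<open>Two positions in one derivation: the second is at or below the first, strictly above it,
  or beside it. In the last case \<open>u\<close> lies in a side tree of \<open>A\<close>, hence is
  no heavier than \<open>A\<close> and survives at the same depth when \<open>t\<close> is
  exchanged.\<close>

lemma plug_cases:
  assumes "plug A t = plug B u"
  shows "(\<exists>Y. B = A @ Y \<and> t = plug Y u) \<or> (\<exists>Y. Y \<noteq> [] \<and> A = B @ Y) \<or>
    (dsize u \<le> zsize A \<and> (\<forall>t'. \<exists>B'. length B' = length B \<and> plug A t' = plug B' u))"
  using assms
proof (induction A arbitrary: B)
  case Nil
  then show ?case by auto
next
  case (Cons f A)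
  obtain \<rho> ls rs where f: "f = (\<rho>, ls, rs)" by (cases f)
  show ?case
  proof (cases B)
    case Nil
    then show ?thesis by auto
  next
    case (Cons f' B1)
    obtain \<rho>' ls' rs' where f': "f' = (\<rho>', ls', rs')" by (cases f')
    from Cons.prems f f' Cons have \<rho>: "\<rho>' = \<rho>"
      and eq: "ls @ plug A t # rs = ls' @ plug B1 u # rs'" by auto
    from eq obtain m where "ls = ls' @ m \<and> m @ plug A t # rs = plug B1 u # rs' \<or>
        ls @ m = ls' \<and> plug A t # rs = m @ plug B1 u # rs'"
      unfolding append_eq_append_conv2 by blast
    then consider "ls = ls'" | m where "ls' = ls @ plug A t # m" "rs = m @ plug B1 u # rs'"
      | m where "ls = ls' @ plug B1 u # m" "rs' = m @ plug A t # rs"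
      by (cases m) auto
    then show ?thesis
    proof cases
      case 1
      with eq have eq': "plug A t = plug B1 u" "rs = rs'" by auto
      from Cons.IH[OF eq'(1)] show ?thesis
      proof (elim disjE exE conjE)
        assume d: "dsize u \<le> zsize A" and s: "\<forall>t'. \<exists>B'. length B' = length B1 \<and> plug A t' = plug B' u"
        have "\<exists>B'. length B' = length B \<and> plug (f # A) t' = plug B' u" for t'
        proof -
          obtain B' where "length B' = length B1" "plug A t' = plug B' u" using s by blast
          then show ?thesis using Cons f by (intro exI[of _ "f # B'"]) auto
        qed
        with d show ?thesis by auto
      qed (use Cons f f' \<rho> 1 eq' in auto)
    next
      case 2
      have "\<exists>B'. length B' = length B \<and> plug (f # A) t' = plug B' u" for t'
        using Cons f \<rho> 2 by (intro exI[of _ "(\<rho>, ls @ plug A t' # m, rs') # B1"]) auto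
      moreover have "dsize u \<le> zsize (f # A)" using f 2 by (auto simp: fsize_def dsize_plug)
      ultimately show ?thesis by blast
    next
      case 3
      have "\<exists>B'. length B' = length B \<and> plug (f # A) t' = plug B' u" for t'
        using Cons f \<rho> 3 by (intro exI[of _ "(\<rho>, ls', m @ plug A t' # rs) # B1"]) auto
      moreover have "dsize u \<le> zsize (f # A)" using f 3 by (auto simp: fsize_def dsize_plug)
      ultimately show ?thesis by blast
    qed
  qed
qed

text \<open>A subtree too heavy to fit beside the path can be plugged in at one position only.\<close>

lemma zipper_unique:
  assumes "plug A t = plug B t" "zsize A < dsize t"
  shows "A = B"
proof -
  have nil: "Y = []" if "plug Y t = t" for Y
    using size_plug[of t Y] that by simp
  from plug_cases[OF assms(1)] show ?thesis
  proof (elim disjE exE conjE)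
    fix Y assume Y: "B = A @ Y" "t = plug Y t"
    from nil[OF Y(2)[symmetric]] Y(1) show ?thesis by simp
  next
    fix Y assume Y: "Y \<noteq> []" "A = B @ Y"
    with assms(1) have "plug Y t = t" by simp
    with nil Y show ?thesis by metis
  next
    assume "dsize t \<le> zsize A"
    with assms(2) show ?thesis by simp
  qed
qed

end

text \<open>\<open>growth\<close> is the form in which unambiguity enters, \<open>conn\<close> that
  of strong connectedness. The exponent \<open>Suc n\<close> leaves one factor for the choice of the
  root.\<close>

locale connected_rules = weighted_rules R lhs args wt V
  for R :: "'r set" and lhs :: "'r \<Rightarrow> 'n" and args :: "'r \<Rightarrow> 'n list"
    and wt :: "'r \<Rightarrow> nat" and V :: "'n set" +
  assumes finite_R: "finite R" and finite_V: "finite V"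
    and lhs_V: "\<rho> \<in> R \<Longrightarrow> lhs \<rho> \<in> V"
    and growth: "\<exists>\<Gamma>. \<forall>n. finite {t. valid t \<and> dsize t = n} \<and>
      card {t. valid t \<and> dsize t = n} \<le> \<Gamma> ^ Suc n"
    and conn: "M \<in> V \<Longrightarrow> N \<in> V \<Longrightarrow> \<exists>Z. zok M N Z"
    and infinite_valid: "infinite {t. valid t}"
begin

lemma root_V: "valid t \<Longrightarrow> root t \<in> V"
  by (cases t) (auto intro: lhs_V)

section \<open>Long paths, loops, and how many nodes start a loop\<close>

definition max_arity :: nat where
  "max_arity = Max (insert 1 ((\<lambda>\<rho>. length (args \<rho>)) ` R))"

definition max_wt :: nat where
  "max_wt = Max (insert 0 (wt ` R))"

lemma max_arity_ge_1: "1 \<le> max_arity"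
  using finite_R by (simp add: max_arity_def)

lemma valid_arity: "valid (Der \<rho> ts) \<Longrightarrow> length ts \<le> max_arity"
proof -
  assume v: "valid (Der \<rho> ts)"
  then have "length ts = length (args \<rho>)" by (metis length_map valid.simps)
  also have "\<dots> \<le> max_arity" unfolding max_arity_def using finite_R v by (intro Max_ge) auto
  finally show ?thesis .
qed

lemma valid_wt: "valid (Der \<rho> ts) \<Longrightarrow> wt \<rho> \<le> max_wt"
  unfolding max_wt_def using finite_R by (intro Max_ge) auto

lemma sum_list_less_mult:
  "\<forall>x \<in> set xs. f x \<le> (k::nat) \<Longrightarrow> length xs \<le> r \<Longrightarrow> sum_list (map f xs) \<le> r * k"
proof (induction xs arbitrary: r)
  case (Cons x xs)
  then obtain r' where "r = Suc r'" by (cases r) auto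
  with Cons show ?case by (auto intro: add_mono)
qed simp

text \<open>Walk into any child heavier than \<open>y\<close>. The weight lost on the way is that of
  the frame, which is deducted from \<open>lo\<close> as well, so the hypothesis is passed on until
  the collected frames weigh \<open>lo\<close>.\<close>

lemma descend:
  assumes "valid D" "lo + max_wt + max_arity * Suc y \<le> dsize D"
  shows "\<exists>Z t. D = plug Z t \<and> lo \<le> zsize Z \<and> y \<le> dsize t"
  using assms
proof (induction D arbitrary: lo)
  case (Der \<rho> ts)
  show ?case
  proof (cases "lo = 0")
    case True
    with Der.prems(2) max_arity_ge_1 have "y \<le> dsize (Der \<rho> ts)"
      by (metis Suc_leD add_leE le_trans mult_le_mono1 nat_mult_1)
    with True show ?thesis by (intro exI[of _ "[]"]) auto
  next
    case False
    have "\<exists>t \<in> set ts. y < dsize t"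
    proof (rule ccontr)
      assume "\<not> ?thesis"
      then have "sum_list (map dsize ts) \<le> max_arity * y"
        using valid_arity[OF Der.prems(1)] by (intro sum_list_less_mult) auto
      with Der.prems False valid_wt[OF Der.prems(1)] show False by simp
    qed
    then obtain t where t: "t \<in> set ts" "y < dsize t" by blast
    then obtain ls rs where ts: "ts = ls @ t # rs" by (meson split_list)
    let ?f = "(\<rho>, ls, rs)"
    have eq: "Der \<rho> ts = plug [?f] t" using ts by simp
    then have size: "dsize (Der \<rho> ts) = fsize ?f + dsize t" using dsize_plug[of "[?f]" t] by simp
    show ?thesis
    proof (cases "lo \<le> fsize ?f")
      case True
      with eq t show ?thesis by (intro exI[of _ "[?f]"] exI[of _ t]) auto
    next
      case False
      have "valid t" using Der.prems(1) ts by simp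
      moreover have "(lo - fsize ?f) + max_wt + max_arity * Suc y \<le> dsize t"
        using Der.prems(2) size False by simp
      ultimately obtain Z u where "t = plug Z u" "lo - fsize ?f \<le> zsize Z" "y \<le> dsize u"
        using Der.IH[OF t(1)] by blast
      with eq False show ?thesis by (intro exI[of _ "?f # Z"] exI[of _ u]) auto
    qed
  qed
qed

text \<open>A size that forces a path with \<open>j\<close> consecutive segments of weight at least
  \<open>lo\<close>. It is exponential in \<open>j\<close>, but \<open>j\<close> will be the
  constant \<open>card V * a\<close>; in \<open>lo\<close> it is linear.\<close>

definition big :: "nat \<Rightarrow> nat \<Rightarrow> nat" where
  "big lo j = (lo + max_wt + max_arity) * Suc max_arity ^ j"

lemma chain:
  "valid D \<Longrightarrow> big lo j \<le> dsize D \<Longrightarrow>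
    \<exists>Zs t. length Zs = j \<and> (\<forall>Z \<in> set Zs. lo \<le> zsize Z) \<and> D = plug (concat Zs) t"
proof (induction j arbitrary: D)
  case 0
  then show ?case by auto
next
  case (Suc j)
  let ?x = "lo + max_wt + max_arity"
  have "?x \<le> big lo j" by (simp add: big_def)
  moreover have "big lo (Suc j) = big lo j + max_arity * big lo j"
    by (simp add: big_def algebra_simps)
  ultimately have "lo + max_wt + max_arity * Suc (big lo j) \<le> big lo (Suc j)" by simp
  then obtain Z t where Z: "D = plug Z t" "lo \<le> zsize Z" "big lo j \<le> dsize t"
    using descend[OF Suc.prems(1)] Suc.prems(2) le_trans by metis
  moreover have "valid t" using Z Suc.prems valid_plugD by blast
  ultimately obtain Zs u where "length Zs = j" "\<forall>Z \<in> set Zs. lo \<le> zsize Z" "t = plug (concat Zs) u"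
    using Suc.IH by blast
  with Z show ?case by (intro exI[of _ "Z # Zs"] exI[of _ u]) auto
qed

text \<open>Each cut point is coloured by the root and the size modulo \<open>a\<close> of the
  derivation below it. There is one cut point more than pieces, hence more cut points than colours.
  Two of the same colour enclose a loop of size divisible by \<open>a\<close> that comprises a whole
  piece.\<close>

lemma pigeonhole_loop:
  assumes v: "valid (plug (concat Zs) t)" and len: "card V * a \<le> length Zs" and a: "0 < a"
    and lo: "\<forall>Z \<in> set Zs. lo \<le> zsize Z"
  shows "\<exists>X Y Z. concat Zs = X @ Y @ Z \<and> lo \<le> zsize Y \<and> a dvd zsize Y \<and>
    root (plug Y (plug Z t)) = root (plug Z t)"
proof -
  define u where "u i = plug (concat (drop i Zs)) t" for i
  define col where "col i = (root (u i), dsize (u i) mod a)" for i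
  have "valid (u i)" for i
  proof -
    have "plug (concat Zs) t = plug (concat (take i Zs)) (u i)"
      unfolding u_def by (metis append_take_drop_id concat_append plug_append)
    with v show ?thesis using valid_plugD by metis
  qed
  then have "col ` {..length Zs} \<subseteq> V \<times> {..<a}" using a by (auto simp: col_def root_V)
  moreover have "card (V \<times> {..<a}) < card {..length Zs}" using len by (simp add: card_cartesian_product)
  ultimately have "\<not> inj_on col {..length Zs}"
    using finite_V by (metis card_inj_on_le finite_SigmaI finite_lessThan leD)
  then obtain i j where ij: "i < j" "j \<le> length Zs" "col i = col j"
    unfolding inj_on_def by (metis atMost_iff linorder_neqE_nat)
  define Y where "Y = concat (take (j - i) (drop i Zs))"
  have drop: "drop i Zs = take (j - i) (drop i Zs) @ drop j Zs"
    using ij by (metis append_take_drop_id drop_drop le_add_diff_inverse2 less_imp_le)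
  then have ui: "u i = plug Y (u j)" unfolding u_def Y_def by (metis concat_append plug_append)
  have "concat Zs = concat (take i Zs) @ Y @ concat (drop j Zs)"
    unfolding Y_def using drop by (metis append_take_drop_id concat_append)
  moreover have "lo \<le> zsize Y"
  proof -
    have "take (j - i) (drop i Zs) = Zs ! i # take (j - Suc i) (drop (Suc i) Zs)"
      using ij by (metis Cons_nth_drop_Suc Suc_diff_Suc less_le_trans take_Suc_Cons)
    then have "zsize (Zs ! i) \<le> zsize Y" by (simp add: Y_def)
    moreover have "lo \<le> zsize (Zs ! i)" using lo ij by simp
    ultimately show ?thesis by simp
  qed
  moreover have "a dvd zsize Y"
  proof -
    have "(zsize Y + dsize (u j)) mod a = dsize (u j) mod a"
      using ij(3) ui by (simp add: col_def dsize_plug)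
    then show ?thesis by (metis add_diff_cancel_right' le_add2 mod_eq_dvd_iff_nat)
  qed
  moreover have "root (plug Y (u j)) = root (u j)" using ij(3) ui by (simp add: col_def)
  ultimately show ?thesis unfolding u_def by blast
qed

lemma exists_loop:
  assumes "valid D" "0 < a" "big lo (card V * a) \<le> dsize D"
  shows "\<exists>X Y t. D = plug X (plug Y t) \<and> lo \<le> zsize Y \<and> a dvd zsize Y \<and> root (plug Y t) = root t"
proof -
  obtain Zs t where Zs: "length Zs = card V * a" "\<forall>Z \<in> set Zs. lo \<le> zsize Z"
    and D: "D = plug (concat Zs) t" using chain[OF assms(1,3)] by blast
  then show ?thesis
    using pigeonhole_loop[of Zs t a lo] assms by (metis le_refl plug_append)
qed

text \<open>The nodes at which a replaceable loop starts: divisibility by \<open>a\<close> lets the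
  replacement match its size, \<open>lo\<close> leaves room for \<open>S\<close>, and
  \<open>hi\<close> keeps the number of possible loops under control.\<close>

definition is_top :: "nat \<Rightarrow> nat \<Rightarrow> nat \<Rightarrow> 'r deriv \<Rightarrow> bool" where
  "is_top a lo hi u \<longleftrightarrow> (\<exists>L v. u = plug L v \<and> root u = root v \<and> a dvd zsize L \<and>
     lo \<le> zsize L \<and> zsize L \<le> hi)"

lemma split_prefix:
  assumes "\<forall>f \<in> set Z. fsize f \<le> F" "lo \<le> zsize Z"
  shows "\<exists>X Y. Z = X @ Y \<and> lo \<le> zsize X \<and> zsize X \<le> lo + F"
  using assms
proof (induction Z arbitrary: lo)
  case (Cons f Z)
  show ?case
  proof (cases "lo = 0")
    case True
    then show ?thesis by (intro exI[of _ "[]"] exI[of _ "f # Z"]) auto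
  next
    case False
    have "lo - fsize f \<le> zsize Z" using Cons.prems by simp
    then obtain X Y where XY: "Z = X @ Y" "lo - fsize f \<le> zsize X" "zsize X \<le> lo - fsize f + F"
      using Cons.IH[of "lo - fsize f"] Cons.prems(1) by auto
    show ?thesis
    proof (cases "lo \<le> fsize f")
      case True
      then show ?thesis using Cons.prems by (intro exI[of _ "[f]"] exI[of _ Z]) auto
    next
      case False
      then show ?thesis using XY by (intro exI[of _ "f # X"] exI[of _ Y]) auto
    qed
  qed
qed auto

text \<open>Cut greedily: a piece overshoots \<open>lo\<close> by at most one frame, so it costs at
  most \<open>lo + F\<close>.\<close>

lemma split_pieces:
  assumes "\<forall>f \<in> set Z. fsize f \<le> F" "j * (lo + F) \<le> zsize Z"
  shows "\<exists>Zs Y. Z = concat Zs @ Y \<and> length Zs = j \<and> (\<forall>X \<in> set Zs. lo \<le> zsize X)"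
  using assms
proof (induction j arbitrary: Z)
  case 0
  then show ?case by auto
next
  case (Suc j)
  from Suc.prems have "lo \<le> zsize Z" by simp
  with Suc.prems split_prefix obtain X Y where XY: "Z = X @ Y" "lo \<le> zsize X" "zsize X \<le> lo + F"
    by blast
  moreover have "\<forall>f \<in> set Y. fsize f \<le> F" "j * (lo + F) \<le> zsize Y" using XY Suc.prems by auto
  ultimately obtain Zs Y' where "Y = concat Zs @ Y'" "length Zs = j" "\<forall>X \<in> set Zs. lo \<le> zsize X"
    using Suc.IH by blast
  with XY show ?case by (intro exI[of _ "X # Zs"] exI[of _ Y']) auto
qed

text \<open>\<open>Z\<close> is a stretch of path above \<open>D\<close> with light side trees and not yet charged to a loop.
  As long as \<open>D\<close> has a single big child the stretch grows, until it is heavy enough to contain a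
  loop by itself. A node with two big children gains the additive constant \<open>B\<close> once more.\<close>

lemma count_tops_aux:
  assumes lo: "0 < lo" and a: "0 < a" and K: "K = big lo (card V * a)"
    and F: "F = max_wt + max_arity * K" and W: "W = card V * a * (lo + F)" and B: "B = W + F"
    and P: "P = is_top a lo B"
  shows "valid (plug Z D) \<Longrightarrow> K \<le> dsize D \<Longrightarrow> \<forall>f \<in> set Z. fsize f \<le> F \<Longrightarrow> zsize Z \<le> W \<Longrightarrow>
    dsize (plug Z D) + B \<le> 2 * B * ntops P (plug Z D)"
proof (induction D arbitrary: Z)
  case (Der \<rho> ts)
  let ?D = "Der \<rho> ts"
  have vD: "valid ?D" using Der.prems(1) valid_plugD by blast
  note arity = valid_arity[OF vD] and wt = valid_wt[OF vD]
  consider (none) "\<forall>t \<in> set ts. dsize t < K"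
    | (one) ls c rs where "ts = ls @ c # rs" "K \<le> dsize c" "\<forall>t \<in> set (ls @ rs). dsize t < K"
    | (two) l1 c1 l2 c2 l3 where "ts = l1 @ c1 # l2 @ c2 # l3" "K \<le> dsize c1" "K \<le> dsize c2"
  proof (cases "\<forall>t \<in> set ts. dsize t < K")
    case False
    then obtain c where "c \<in> set ts" "K \<le> dsize c" by (auto simp: not_less)
    then obtain ls rs where c: "ts = ls @ c # rs" "K \<le> dsize c" by (meson split_list)
    show thesis
    proof (cases "\<forall>t \<in> set (ls @ rs). dsize t < K")
      case True
      with c one show thesis by blast
    next
      case False
      then consider d where "d \<in> set ls" "K \<le> dsize d" | d where "d \<in> set rs" "K \<le> dsize d"
        by (auto simp: not_less)
      then show thesis
      proof cases
        case 1
        then obtain l1 l2 where "ls = l1 @ d # l2" by (meson split_list)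
        with c 1 two[of l1 d l2 c rs] show thesis by simp
      next
        case 2
        then obtain l1 l2 where "rs = l1 @ d # l2" by (meson split_list)
        with c 2 two[of ls c l1 d l2] show thesis by simp
      qed
    qed
  qed (use none in blast)
  then show ?case
  proof cases
    case none
    then have "sum_list (map dsize ts) \<le> max_arity * K"
      using arity by (intro sum_list_less_mult) (auto intro: less_imp_le)
    then have size: "dsize ?D \<le> F" using wt F by simp
    obtain X Y t where XY: "?D = plug X (plug Y t)" "lo \<le> zsize Y" "a dvd zsize Y"
      "root (plug Y t) = root t" using exists_loop[OF vD a] Der.prems(2) K by blast
    have "zsize Y \<le> dsize ?D" using XY(1) by (simp add: dsize_plug)
    then have "P (plug Y t)" using XY size B unfolding P is_top_def by fastforce
    then have "1 \<le> ntops P (plug (Z @ X) (plug Y t))"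
      using ntops_pos[of P "plug Y t"] ntops_plug[of P "plug Y t" "Z @ X"] by linarith
    then have "1 \<le> ntops P (plug Z ?D)" using XY(1) by simp
    then have "2 * B * 1 \<le> 2 * B * ntops P (plug Z ?D)" by (rule mult_le_mono2)
    \<comment> \<open>The stretch weighs at most \<open>W\<close> and the derivation below it at
      most \<open>F\<close>, together \<open>B\<close>; one top pays for this and for the additional
      \<open>B\<close>.\<close>
    then show ?thesis using size Der.prems(4) B dsize_plug[of Z ?D] by linarith
  next
    case one
    let ?f = "(\<rho>, ls, rs)"
    have eq: "plug Z ?D = plug (Z @ [?f]) c" using one by simp
    have "length (ls @ rs) \<le> max_arity" using arity one by simp
    then have "sum_list (map dsize (ls @ rs)) \<le> max_arity * K"
      using one by (intro sum_list_less_mult) (auto intro: less_imp_le)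
    then have f: "fsize ?f \<le> F" using wt F by (simp add: fsize_def)
    have c: "c \<in> set ts" "valid c" using one vD by auto
    have frames: "\<forall>g \<in> set (Z @ [?f]). fsize g \<le> F" using f Der.prems(3) by auto
    show ?thesis
    proof (cases "zsize (Z @ [?f]) \<le> W")
      case True
      have "valid (plug (Z @ [?f]) c)" using Der.prems(1) eq by simp
      from Der.IH[OF c(1) this one(2) frames True] show ?thesis using eq by simp
    next
      case False
      \<comment> \<open>The stretch is now heavy enough for a loop of its own. Its top lies above
        \<open>c\<close> and so is not among the tops of \<open>c\<close>; it pays for the stretch,
        and counting restarts at \<open>c\<close> with an empty stretch.\<close>
      then have "card V * a * (lo + F) \<le> zsize (Z @ [?f])" using W by simp
      then obtain Zs Y where Zs: "Z @ [?f] = concat Zs @ Y" "length Zs = card V * a"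
        "\<forall>X \<in> set Zs. lo \<le> zsize X" using split_pieces[OF frames] by blast
      have "valid (plug (concat Zs) (plug Y c))" using Der.prems(1) eq Zs(1) by simp
      then obtain X1 X2 X3 where X: "concat Zs = X1 @ X2 @ X3" "lo \<le> zsize X2" "a dvd zsize X2"
        "root (plug X2 (plug X3 (plug Y c))) = root (plug X3 (plug Y c))"
        using pigeonhole_loop[of Zs "plug Y c" a lo] Zs a by auto
      have "zsize X2 \<le> zsize (Z @ [?f])" using X(1) Zs(1) by simp
      also have size: "\<dots> \<le> B" using Der.prems(4) f B by simp
      finally have "P (plug X2 (plug (X3 @ Y) c))" using X unfolding P is_top_def by fastforce
      moreover obtain g X2' where "X2 = g # X2'" using X(2) lo by (cases X2) auto
      ultimately have "Suc (ntops P (plug (X3 @ Y) c)) \<le> ntops P (plug X2 (plug (X3 @ Y) c))"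
        using ntops_plug_Cons[of P g X2' "plug (X3 @ Y) c"] by simp
      then have "Suc (ntops P c) \<le> ntops P (plug X1 (plug X2 (plug (X3 @ Y) c)))"
        using ntops_plug[of P c "X3 @ Y"] ntops_plug[of P "plug X2 (plug (X3 @ Y) c)" X1] by linarith
      then have "Suc (ntops P c) \<le> ntops P (plug Z ?D)" using eq X(1) Zs(1) by simp
      then have "2 * B * Suc (ntops P c) \<le> 2 * B * ntops P (plug Z ?D)" by (rule mult_le_mono2)
      moreover have "dsize c + B \<le> 2 * B * ntops P c"
        using Der.IH[OF c(1), of "[]"] c one by simp
      moreover have "dsize (plug Z ?D) = zsize (Z @ [?f]) + dsize c" using eq dsize_plug by metis
      ultimately show ?thesis using size unfolding mult_Suc_right by linarith
    qed
  next
    case two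
    have big: "dsize t + B \<le> 2 * B * ntops P t" if "t \<in> set ts" "K \<le> dsize t" for t
      using Der.IH[OF that(1), of "[]"] that vD by (auto simp: list_all_iff)
    then have le: "dsize t \<le> 2 * B * ntops P t + K" if "t \<in> set ts" for t
      using that by (cases "K \<le> dsize t") fastforce+
    have sum: "sum_list (map dsize us) \<le> 2 * B * sum_list (map (ntops P) us) + length us * K"
      if "set us \<subseteq> set ts" for us
      using that by (induction us) (use le in \<open>force simp: algebra_simps\<close>)+
    \<comment> \<open>Two spare terms \<open>B\<close> become available. One covers the stretch, the
      rule and the allowance \<open>K\<close> for each remaining child, since
      \<open>W + max_wt + max_arity * K = B\<close>; the other one is passed on.\<close>
    have "dsize c1 + B \<le> 2 * B * ntops P c1" "dsize c2 + B \<le> 2 * B * ntops P c2"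
      using big two by auto
    moreover have "sum_list (map dsize (l1 @ l2 @ l3)) \<le>
        2 * B * sum_list (map (ntops P) (l1 @ l2 @ l3)) + length (l1 @ l2 @ l3) * K"
      using two by (intro sum) auto
    moreover have "length (l1 @ l2 @ l3) * K \<le> max_arity * K"
      using arity two by (intro mult_le_mono1) simp
    ultimately have "sum_list (map dsize ts) + 2 * B \<le>
        2 * B * sum_list (map (ntops P) ts) + max_arity * K"
      using two(1) by (simp add: algebra_simps)
    moreover have "2 * B * sum_list (map (ntops P) ts) \<le> 2 * B * ntops P (plug Z ?D)"
      using ntops_plug[of P ?D Z] by (intro mult_le_mono2) auto
    moreover have "dsize ?D = wt \<rho> + sum_list (map dsize ts)" by simp
    ultimately show ?thesis using wt F B Der.prems(4) dsize_plug[of Z ?D] by linarith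
  qed
qed

definition big_bound :: "nat \<Rightarrow> nat \<Rightarrow> nat" where
  "big_bound a lo = card V * a * (lo + (max_wt + max_arity * big lo (card V * a))) +
     (max_wt + max_arity * big lo (card V * a))"

lemma count_tops:
  assumes "0 < lo" "0 < a" "valid D" "big lo (card V * a) \<le> dsize D"
  shows "dsize D \<le> 2 * big_bound a lo * ntops (is_top a lo (big_bound a lo)) D"
  using count_tops_aux[OF assms(1,2) refl refl refl refl refl, of "[]" D] assms(3,4)
  by (simp add: big_bound_def)

section \<open>Replacing loops\<close>

text \<open>Iterating a nonempty loop of weight 0 would produce infinitely many derivations of one
  size, against \<open>growth\<close>.\<close>

lemma zero_loop:
  assumes v: "valid (plug X u)" and r: "root (plug X u) = root u" and z: "zsize X = 0"
  shows "X = []"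
proof (rule ccontr)
  assume ne: "X \<noteq> []"
  define f where "f k = plug (zpow k X) u" for k
  have "valid u" using v valid_plugD by blast
  moreover have "zok (root u) (root u) X" using zok_plug[OF v] r by simp
  ultimately have "valid (f k)" for k unfolding f_def using zok_zpow zokD(1) by blast
  moreover have "dsize (f k) = dsize u" for k by (simp add: f_def dsize_plug z)
  ultimately have sub: "range f \<subseteq> {t. valid t \<and> dsize t = dsize u}" by auto
  have "size (f k) < size (f (Suc k))" for k
    using size_plug[of "f k" X] ne by (cases X) (auto simp: f_def)
  then have "strict_mono (\<lambda>k. size (f k))" by (simp add: strict_mono_Suc_iff)
  then have "inj f" by (metis injI strict_mono_eq)
  then have "infinite (range f)" by (rule range_inj_infinite)
  moreover have "finite (range f)" using growth sub finite_subset by blast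
  ultimately show False by simp
qed

text \<open>Along the path the pairs of root and size are pairwise distinct, because a repetition
  would enclose a nonempty loop of weight 0. The bound is the number of such pairs.\<close>

lemma length_zipper_le:
  assumes v: "valid (plug X u)"
  shows "length X < card V * Suc (dsize (plug X u))"
proof -
  define c where "c i = (root (plug (drop i X) u), dsize (plug (drop i X) u))" for i
  have eq: "plug X u = plug (take i X) (plug (drop i X) u)" for i
    by (metis append_take_drop_id plug_append)
  then have val: "valid (plug (drop i X) u)" for i using v valid_plugD by metis
  have "dsize (plug (drop i X) u) \<le> dsize (plug X u)" for i
    using eq[of i] dsize_plug by (metis le_add2)
  then have sub: "c ` {..length X} \<subseteq> V \<times> {..dsize (plug X u)}"
    using val root_V by (auto simp: c_def)
  have "c i \<noteq> c j" if "i < j" "j \<le> length X" for i j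
  proof
    assume e: "c i = c j"
    define Y where "Y = take (j - i) (drop i X)"
    have "drop i X = Y @ drop j X"
      unfolding Y_def using that by (metis append_take_drop_id drop_drop le_add_diff_inverse2 less_imp_le)
    then have Y: "plug (drop i X) u = plug Y (plug (drop j X) u)" by simp
    with e have "root (plug Y (plug (drop j X) u)) = root (plug (drop j X) u)" "zsize Y = 0"
      by (auto simp: c_def dsize_plug)
    then have "Y = []" using zero_loop val[of i] Y by metis
    then show False using that by (simp add: Y_def)
  qed
  then have "inj_on c {..length X}"
    unfolding inj_on_def by (metis atMost_iff linorder_neqE_nat)
  then have "card {..length X} \<le> card (V \<times> {..dsize (plug X u)})"
    using sub finite_V by (intro card_inj_on_le) auto
  then show ?thesis by (simp add: card_cartesian_product)
qed

lemma inhabited: "M \<in> V \<Longrightarrow> \<exists>t. valid t \<and> root t = M"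
proof -
  assume M: "M \<in> V"
  obtain t where t: "valid t" using infinite_valid not_finite_existsD by blast
  then obtain Z where "zok M (root t) Z" using conn M root_V by blast
  then show ?thesis using zokD t by blast
qed

lemma finite_dsize_le: "finite {t. valid t \<and> dsize t \<le> n}"
proof -
  have "{t. valid t \<and> dsize t \<le> n} = (\<Union>m \<le> n. {t. valid t \<and> dsize t = m})" by auto
  then show ?thesis using growth by auto
qed

text \<open>Some large derivation contains one loop of positive size; connecting paths lead every
  nonterminal through it. Iteration then brings all these loops to the product of their
  sizes.\<close>

lemma exists_loops: "\<exists>a > 0. \<exists>C. \<forall>M \<in> V. zok M M (C M) \<and> zsize (C M) = a"
proof -
  let ?K = "big 1 (card V * 1)"
  have "\<not> {t. valid t} \<subseteq> {t. valid t \<and> dsize t \<le> ?K}"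
    using infinite_valid finite_dsize_le finite_subset by blast
  then obtain D where "valid D" "\<not> dsize D \<le> ?K" by blast
  then have D: "valid D" "?K \<le> dsize D" by simp_all
  then obtain X Y t where XY: "D = plug X (plug Y t)" "1 \<le> zsize Y" "root (plug Y t) = root t"
    using exists_loop[of D 1 1] by auto
  then have "valid (plug Y t)" using D valid_plugD by blast
  with XY have Y: "zok (root t) (root t) Y" "root t \<in> V"
    using zok_plug root_V valid_plugD by metis+
  have "\<exists>Z. zok M M Z \<and> 0 < zsize Z" if M: "M \<in> V" for M
  proof -
    obtain A B where "zok M (root t) A" "zok (root t) M B" using conn M Y(2) by metis
    then have "zok M M (A @ Y @ B)" using Y(1) zok_append by blast
    with XY(2) show ?thesis by (intro exI[of _ "A @ Y @ B"]) auto
  qed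
  then obtain Z where Z: "\<And>M. M \<in> V \<Longrightarrow> zok M M (Z M) \<and> 0 < zsize (Z M)" by metis
  define a where "a = (\<Prod>M\<in>V. zsize (Z M))"
  define C where "C M = zpow (a div zsize (Z M)) (Z M)" for M
  show ?thesis
  proof (intro exI conjI ballI)
    show "0 < a" unfolding a_def using Z by (simp add: prod_pos)
    fix M assume M: "M \<in> V"
    then have "zsize (Z M) dvd a" unfolding a_def using finite_V by (intro dvd_prodI)
    then show "zsize (C M) = a" by (simp add: C_def)
    show "zok M M (C M)" unfolding C_def using Z[OF M] zok_zpow by blast
  qed
qed

text \<open>Depth makes the occurrence useful as a marker: after a replacement at \<open>E\<close>
  it cannot start strictly above \<open>E\<close>, so \<open>E\<close> is a prefix of its
  position.\<close>

lemma deepest_occurrence: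
  assumes "contains Z D"
  shows "\<exists>F u. D = plug F (plug Z u) \<and> (\<forall>F' u'. D = plug F' (plug Z u') \<longrightarrow> length F' \<le> length F)"
proof -
  let ?P = "\<lambda>F. \<exists>u. D = plug F (plug Z u)"
  obtain F0 where F0: "?P F0" using assms unfolding contains_def by blast
  have "\<forall>F. ?P F \<longrightarrow> length F < Suc (size D)"
  proof (intro allI impI)
    fix F assume "?P F"
    then obtain u where "D = plug F (plug Z u)" by blast
    then show "length F < Suc (size D)" using size_plug[of "plug Z u" F] by simp
  qed
  from ex_has_greatest_nat[of ?P F0 length, OF F0 this]
  show ?thesis by blast
qed

text \<open>Replacing \<open>L\<close> by \<open>U\<close> creates the first occurrences of \<open>Z\<close>, hence every deepest one is close
  to the place of the replacement.\<close>

lemma deepest_occurrence_near: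
  assumes no: "\<not> contains Z (plug E (plug L v))" and U: "U = A @ Z @ B"
    and F: "plug E (plug U v) = plug F (plug Z u)"
    and deep: "\<And>F' u'. plug E (plug U v) = plug F' (plug Z u') \<Longrightarrow> length F' \<le> length F"
    and t: "valid (plug U t)"
  shows "\<exists>Y. F = E @ Y \<and> length Y \<le> card V * Suc (dsize (plug U t))"
  using plug_cases[OF F]
proof (elim disjE exE conjE)
  fix Y assume Y: "F = E @ Y" "plug U v = plug Y (plug Z u)"
  have "length Y \<le> card V * Suc (dsize (plug U t))"
    using plug_cases[OF Y(2)]
  proof (elim disjE exE conjE)
    fix Y' assume "Y = U @ Y'" "v = plug Y' (plug Z u)"
    then have "plug E (plug L v) = plug (E @ L @ Y') (plug Z u)" by simp
    then have "contains Z (plug E (plug L v))" unfolding contains_def by blast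
    with no show ?thesis by simp
  next
    fix Y' assume "U = Y @ Y'"
    then have "length Y \<le> length U" by simp
    then show ?thesis using length_zipper_le[OF t] by simp
  next
    assume "\<forall>t'. \<exists>B'. length B' = length Y \<and> plug U t' = plug B' (plug Z u)"
    \<comment> \<open>An occurrence in a side tree of \<open>U\<close> does not depend on what fills
      \<open>U\<close>. Its depth can be measured with the given \<open>t\<close> in place of
      \<open>v\<close>, which may be arbitrarily large.\<close>
    then obtain B' where "length B' = length Y" "plug U t = plug B' (plug Z u)" by blast
    then show ?thesis using length_zipper_le[of B' "plug Z u"] t by simp
  qed
  with Y show ?thesis by blast
next
  fix Y assume Y: "Y \<noteq> []" "E = F @ Y"
  \<comment> \<open>The occurrence inside \<open>U\<close> starts at or below \<open>E\<close>, so a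
    deepest one cannot start strictly above \<open>E\<close>.\<close>
  have "plug E (plug U v) = plug (E @ A) (plug Z (plug B v))" using U by simp
  from deep[OF this] Y show ?thesis by (cases Y) auto
next
  assume "\<forall>t'. \<exists>B'. length B' = length F \<and> plug E t' = plug B' (plug Z u)"
  then have "contains Z (plug E (plug L v))" unfolding contains_def by blast
  with no show ?thesis by simp
qed

text \<open>Let \<open>x = a * b\<close>, and let \<open>W\<close> be a loop from \<open>M\<close>
  through \<open>Z\<close>. Taking \<open>W\<close> exactly \<open>a\<close> times gives size
  \<open>a * zsize W\<close>, and \<open>b - zsize W\<close> loops of size \<open>a\<close> add the
  rest; the lower bound on \<open>x\<close> prevents truncation of this difference.\<close>

lemma replacement_exists:
  assumes Z: "zok Q P Z" "Q \<in> V" "P \<in> V" and M: "M \<in> V"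
    and con: "\<And>M N. M \<in> V \<Longrightarrow> N \<in> V \<Longrightarrow> \<exists>X. zok M N X \<and> zsize X \<le> c"
    and l: "zok M M C" "zsize C = a" "0 < a"
    and x: "a dvd x" "a * (zsize Z + 2 * c) \<le> x"
  shows "\<exists>U. zok M M U \<and> zsize U = x \<and> (\<exists>A B. U = A @ Z @ B)"
proof -
  obtain X Y where X: "zok M Q X" "zsize X \<le> c" and Y: "zok P M Y" "zsize Y \<le> c"
    using con Z M by meson
  define W where "W = X @ Z @ Y"
  have W: "zok M M W" unfolding W_def using X Y Z zok_append by blast
  have "zsize W \<le> zsize Z + 2 * c" using X Y by (simp add: W_def)
  then have le: "a * zsize W \<le> x" using x(2) by (meson le_trans mult_le_mono2)
  obtain b where b: "x = a * b" using x(1) by blast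
  obtain a' where a': "a = Suc a'" using l(3) by (cases a) auto
  let ?U = "zpow a W @ zpow (b - zsize W) C"
  have "zsize W \<le> b" using le b l(3) by simp
  then have "a * zsize W + (b - zsize W) * a = x" using b by (metis add_mult_distrib2 le_add_diff_inverse mult.commute)
  then have "zsize ?U = x" using l(2) by simp
  moreover have "zok M M ?U" using W l(1) zok_zpow zok_append by blast
  moreover have "?U = X @ Z @ (Y @ zpow a' W @ zpow (b - zsize W) C)" by (simp add: a' W_def)
  ultimately show ?thesis by blast
qed

text \<open>Pairs of a bad derivation and a top in it are counted twice. From below each bad
  derivation contributes its tops; from above an injective code is used, and the four factors beside
  \<open>A\<close> count the values of its four components.\<close>

lemma swap_count:
  assumes rep: "\<And>M x. M \<in> V \<Longrightarrow> a dvd x \<Longrightarrow> lo \<le> x \<Longrightarrow>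
      zok M M (rep M x) \<and> zsize (rep M x) = x \<and> (\<exists>A B. rep M x = A @ Z @ B)"
    and tm: "\<And>M. M \<in> V \<Longrightarrow> valid (tm M) \<and> root (tm M) = M \<and> hi < dsize (tm M) \<and> dsize (tm M) \<le> y"
    and T: "T = {t. valid t \<and> root t = N \<and> dsize t = n}"
    and bad: "bad = {t \<in> T. \<not> contains Z t}"
    and A: "\<And>t. t \<in> bad \<Longrightarrow> n \<le> A * ntops (is_top a lo hi) t"
  shows "card bad * n \<le> A * (card T * Suc (card V * Suc (hi + y)) * Suc hi * card {t. valid t \<and> dsize t \<le> hi + y})"
proof -
  let ?top = "is_top a lo hi"
  let ?tops = "\<lambda>t. {E. \<exists>u. t = plug E u \<and> ?top u}"
  define \<Omega> where "\<Omega> = {(E, u). plug E u \<in> bad \<and> ?top u}"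
  have finT: "finite T"
    by (rule finite_subset[OF _ finite_dsize_le[of n]]) (auto simp: T)
  then have finB: "finite bad" by (simp add: bad)
  have "\<forall>u. \<exists>p. ?top u \<longrightarrow> u = plug (fst p) (snd p) \<and> root u = root (snd p) \<and>
      a dvd zsize (fst p) \<and> lo \<le> zsize (fst p) \<and> zsize (fst p) \<le> hi"
    by (auto simp: is_top_def)
  then obtain p where "\<And>u. ?top u \<Longrightarrow> u = plug (fst (p u)) (snd (p u)) \<and> root u = root (snd (p u)) \<and>
      a dvd zsize (fst (p u)) \<and> lo \<le> zsize (fst (p u)) \<and> zsize (fst (p u)) \<le> hi"
    by metis
  then obtain L v where Lv: "\<And>u. ?top u \<Longrightarrow> u = plug (L u) (v u) \<and> root u = root (v u) \<and>
      a dvd zsize (L u) \<and> lo \<le> zsize (L u) \<and> zsize (L u) \<le> hi"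
    by (rule that[of "\<lambda>u. fst (p u)" "\<lambda>u. snd (p u)"])
  have "\<forall>D. \<exists>F. contains Z D \<longrightarrow> (\<exists>w. D = plug F (plug Z w)) \<and>
      (\<forall>F' u'. D = plug F' (plug Z u') \<longrightarrow> length F' \<le> length F)"
    using deepest_occurrence[of Z] by blast
  then obtain F where F: "\<And>D. contains Z D \<Longrightarrow> (\<exists>w. D = plug (F D) (plug Z w)) \<and>
      (\<forall>F' u'. D = plug F' (plug Z u') \<longrightarrow> length F' \<le> length (F D))"
    by metis
  \<comment> \<open>\<open>U u\<close> depends on \<open>u\<close> only through
    \<open>root u\<close> and \<open>zsize (L u)\<close>, so it can be reconstructed after the
    replacement.\<close>
  define U where "U u = rep (root u) (zsize (L u))" for u
  define D where "D = (\<lambda>(E, u). plug E (plug (U u) (v u)))"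
  \<comment> \<open>Decoding: the first two entries give \<open>E\<close> as a prefix of the deepest
    occurrence. The subtree at \<open>E\<close> gives the root, the third entry then gives
    \<open>U u\<close>, and cancelling it gives \<open>v u\<close>. The last entry stores
    \<open>L u\<close>, capped by a fixed derivation so that it is counted among
    derivations.\<close>
  define \<phi> where "\<phi> = (\<lambda>(E, u). (D (E, u), length (F (D (E, u))) - length E, zsize (L u), plug (L u) (tm (root u))))"
  let ?C = "T \<times> {..card V * Suc (hi + y)} \<times> {..hi} \<times> {t. valid t \<and> dsize t \<le> hi + y}"
  have props: "valid u" "root u \<in> V" "valid (v u)" "root (v u) = root u" "zok (root u) (root u) (U u)"
      "zsize (U u) = zsize (L u)" "\<exists>A B. U u = A @ Z @ B" "D (E, u) \<in> T" "contains Z (D (E, u))"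
      "\<exists>Y. F (D (E, u)) = E @ Y \<and> length Y \<le> card V * Suc (hi + y)"
      "valid (plug (L u) (tm (root u)))" "dsize (plug (L u) (tm (root u))) \<le> hi + y"
    if "(E, u) \<in> \<Omega>" for E u
  proof -
    from that have Eu: "valid (plug E u)" "root (plug E u) = N" "dsize (plug E u) = n"
      "\<not> contains Z (plug E u)" "?top u" by (auto simp: \<Omega>_def bad T)
    note top = Lv[OF Eu(5)]
    show u: "valid u" using Eu(1) valid_plugD by blast
    show M: "root u \<in> V" using u root_V by blast
    show v: "valid (v u)" using top u valid_plugD by metis
    show rv: "root (v u) = root u" using top by simp
    have U: "zok (root u) (root u) (U u)" "zsize (U u) = zsize (L u)" "\<exists>A B. U u = A @ Z @ B"
      unfolding U_def using rep[OF M] top by auto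
    show "zok (root u) (root u) (U u)" "zsize (U u) = zsize (L u)" "\<exists>A B. U u = A @ Z @ B"
      by (fact U)+
    have Ru: "valid (plug (U u) (v u))" "root (plug (U u) (v u)) = root u"
      using zokD[OF U(1) v rv] by auto
    have "dsize (plug (U u) (v u)) = dsize u"
      using top U(2) dsize_plug by metis
    then show "D (E, u) \<in> T"
      using valid_plug_exchange[OF Eu(1) Ru] Eu(2,3) by (simp add: D_def T dsize_plug)
    obtain A B where AB: "U u = A @ Z @ B" using U(3) by blast
    have "D (E, u) = plug (E @ A) (plug Z (plug B (v u)))" by (simp add: D_def AB)
    then show con: "contains Z (D (E, u))" unfolding contains_def by blast
    note t = tm[OF M]
    have zL: "zok (root u) (root u) (L u)" using zok_plug[of "L u" "v u"] top u by metis
    then show "valid (plug (L u) (tm (root u)))" using t zokD by blast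
    show le: "dsize (plug (L u) (tm (root u))) \<le> hi + y" using t top by (simp add: dsize_plug)
    obtain w where w: "D (E, u) = plug (F (D (E, u))) (plug Z w)" using F[OF con] by blast
    have "\<exists>Y. F (D (E, u)) = E @ Y \<and> length Y \<le> card V * Suc (dsize (plug (U u) (tm (root u))))"
    proof (rule deepest_occurrence_near[OF _ AB])
      show "\<not> contains Z (plug E (plug (L u) (v u)))" using Eu(4) top by simp
      show "plug E (plug (U u) (v u)) = plug (F (D (E, u))) (plug Z w)"
        using w by (simp add: D_def)
      show "length F' \<le> length (F (D (E, u)))" if "plug E (plug (U u) (v u)) = plug F' (plug Z u')" for F' u'
        using F[OF con] that by (auto simp: D_def)
      show "valid (plug (U u) (tm (root u)))" using U(1) t zokD by blast
    qed
    moreover have "card V * Suc (dsize (plug (U u) (tm (root u)))) \<le> card V * Suc (hi + y)"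
      using le U(2) by (intro mult_le_mono2) (simp add: dsize_plug)
    ultimately show "\<exists>Y. F (D (E, u)) = E @ Y \<and> length Y \<le> card V * Suc (hi + y)"
      using le_trans by blast
  qed
  have "inj_on \<phi> \<Omega>"
  proof (rule inj_onI)
    fix p p' assume p: "p \<in> \<Omega>" and p': "p' \<in> \<Omega>" and eq: "\<phi> p = \<phi> p'"
    obtain E u E' u' where pp: "p = (E, u)" "p' = (E', u')" by (cases p, cases p') auto
    have Deq: "D (E, u) = D (E', u')" and len: "length (F (D (E, u))) - length E = length (F (D (E', u'))) - length E'"
      and zeq: "zsize (L u) = zsize (L u')" and peq: "plug (L u) (tm (root u)) = plug (L u') (tm (root u'))"
      using eq by (auto simp: \<phi>_def pp)
    note q = props[OF p[unfolded pp]] and q' = props[OF p'[unfolded pp]]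
    obtain Y Y' where Y: "F (D (E, u)) = E @ Y" "F (D (E', u')) = E' @ Y'" using q(10) q'(10) by blast
    with Deq have "E @ Y = E' @ Y'" by simp
    moreover have "length Y = length Y'" using len Y by simp
    ultimately have E: "E = E'" by simp
    then have Req: "plug (U u) (v u) = plug (U u') (v u')" using Deq by (simp add: D_def)
    have r: "root u = root u'"
      using zokD(2)[OF q(5) q(3,4)] zokD(2)[OF q'(5) q'(3,4)] Req by simp
    have "U u = U u'" using r zeq by (simp add: U_def)
    then have v: "v u = v u'" using Req by simp
    have tops: "?top u" "?top u'" using p p' by (auto simp: \<Omega>_def pp)
    \<comment> \<open>The cap is heavier than \<open>hi\<close>, hence heavier than anything beside
      the path, so its position is unique.\<close>
    have "L u = L u'"
    proof (rule zipper_unique)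
      show "plug (L u) (tm (root u)) = plug (L u') (tm (root u))" using peq r by simp
      show "zsize (L u) < dsize (tm (root u))"
        using Lv[OF tops(1)] tm[OF q(2)] by linarith
    qed
    then have "u = u'" using v Lv[OF tops(1)] Lv[OF tops(2)] by metis
    with E pp show "p = p'" by simp
  qed
  moreover have "\<phi> ` \<Omega> \<subseteq> ?C"
  proof
    fix c assume "c \<in> \<phi> ` \<Omega>"
    then obtain E u where Eu: "(E, u) \<in> \<Omega>" "c = \<phi> (E, u)" by auto
    note q = props[OF Eu(1)]
    have "zsize (L u) \<le> hi" using Lv[of u] Eu(1) by (auto simp: \<Omega>_def)
    then show "c \<in> ?C" using q(8,10,11,12) Eu(2) by (auto simp: \<phi>_def)
  qed
  moreover have finC: "finite ?C" using finT finite_dsize_le by auto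
  ultimately have "card \<Omega> \<le> card ?C" by (rule card_inj_on_le)
  also have "\<dots> = card T * Suc (card V * Suc (hi + y)) * Suc hi * card {t. valid t \<and> dsize t \<le> hi + y}"
    by (simp only: card_cartesian_product card_atMost mult.assoc)
  finally have up: "card \<Omega> \<le> \<dots>" .
  have img: "(\<lambda>(E, u). (plug E u, E)) ` \<Omega> = (SIGMA t:bad. ?tops t)"
    by (force simp: \<Omega>_def)
  have "inj_on (\<lambda>(E, u). (plug E u, E)) \<Omega>" by (auto simp: inj_on_def)
  from card_image[OF this] have "card \<Omega> = card (SIGMA t:bad. ?tops t)" unfolding img by (rule sym)
  also have "\<dots> = (\<Sum>t\<in>bad. ntops ?top t)"
    using finB finite_card_tops[of _ ?top] by (subst card_SigmaI) auto
  finally have "A * card \<Omega> = (\<Sum>t\<in>bad. A * ntops ?top t)" by (simp add: sum_distrib_left)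
  moreover have "(\<Sum>t\<in>bad. n) \<le> (\<Sum>t\<in>bad. A * ntops ?top t)" by (rule sum_mono) (rule A)
  ultimately have "card bad * n \<le> A * card \<Omega>" by simp
  also have "\<dots> \<le> A * (card T * Suc (card V * Suc (hi + y)) * Suc hi * card {t. valid t \<and> dsize t \<le> hi + y})"
    using up by (rule mult_le_mono2)
  finally show ?thesis .
qed

end

section \<open>The proportion of derivations without an occurrence\<close>

text \<open>An explicit bound valid for every \<open>s\<close>, including 0, since the constant
  later becomes an exponent of \<Theta>.\<close>

definition linearly_bounded :: "(nat \<Rightarrow> nat) \<Rightarrow> bool" where
  "linearly_bounded f \<longleftrightarrow> (\<exists>c. \<forall>s. f s \<le> c * Suc s)"

lemma linearly_bounded_intros:
  "linearly_bounded (\<lambda>s. k)"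
  "linearly_bounded (\<lambda>s. s)"
  "linearly_bounded f \<Longrightarrow> linearly_bounded (\<lambda>s. Suc (f s))"
  "linearly_bounded f \<Longrightarrow> linearly_bounded g \<Longrightarrow> linearly_bounded (\<lambda>s. f s + g s)"
  "linearly_bounded f \<Longrightarrow> linearly_bounded (\<lambda>s. k * f s)"
  "linearly_bounded f \<Longrightarrow> linearly_bounded (\<lambda>s. f s * k)"
proof -
  show "linearly_bounded (\<lambda>s. k)"
    unfolding linearly_bounded_def by (rule exI[of _ k]) simp
  show "linearly_bounded (\<lambda>s. s)"
    unfolding linearly_bounded_def by (rule exI[of _ 1]) simp
  show "linearly_bounded f \<Longrightarrow> linearly_bounded (\<lambda>s. Suc (f s))"
  proof -
    assume "linearly_bounded f"
    then obtain c where c: "f s \<le> c * Suc s" for s unfolding linearly_bounded_def by blast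
    have "Suc (f s) \<le> Suc c * Suc s" for s using c[of s] by simp
    then show ?thesis unfolding linearly_bounded_def by blast
  qed
  show "linearly_bounded f \<Longrightarrow> linearly_bounded g \<Longrightarrow> linearly_bounded (\<lambda>s. f s + g s)"
  proof -
    assume "linearly_bounded f" "linearly_bounded g"
    then obtain c d where cd: "f s \<le> c * Suc s" "g s \<le> d * Suc s" for s
      unfolding linearly_bounded_def by blast
    have "f s + g s \<le> (c + d) * Suc s" for s using add_mono[OF cd[of s]] by (simp add: algebra_simps)
    then show ?thesis unfolding linearly_bounded_def by blast
  qed
  show *: "linearly_bounded f \<Longrightarrow> linearly_bounded (\<lambda>s. k * f s)" for k
  proof -
    assume "linearly_bounded f"
    then obtain c where c: "f s \<le> c * Suc s" for s unfolding linearly_bounded_def by blast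
    have "k * f s \<le> (k * c) * Suc s" for s using mult_le_mono2[OF c[of s], of k] by (simp only: mult.assoc)
    then show ?thesis unfolding linearly_bounded_def by blast
  qed
  show "linearly_bounded f \<Longrightarrow> linearly_bounded (\<lambda>s. f s * k)"
    using *[of k] by (simp add: mult.commute)
qed

section \<open>Growth of the number of derivations and the bound for those without an
  occurrence\<close>

context connected_rules
begin

text \<open>Pumping a loop at the root. This is what makes the limit in \<open>has_limdef\<close>
  well-formed.\<close>

lemma infinite_sizes:
  assumes "M \<in> V"
  shows "infinite {n. \<exists>t. valid t \<and> root t = M \<and> dsize t = n}"
  unfolding infinite_nat_iff_unbounded_le
proof
  fix m
  obtain a C where C: "0 < a" "\<And>M. M \<in> V \<Longrightarrow> zok M M (C M) \<and> zsize (C M) = a"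
    using exists_loops by blast
  obtain t where t: "valid t" "root t = M" using inhabited[OF assms] by blast
  let ?t = "plug (zpow m (C M)) t"
  have "zok M M (zpow m (C M))" using C(2)[OF assms] zok_zpow by blast
  then have "valid ?t" "root ?t = M" using zokD t by blast+
  moreover have "m \<le> dsize ?t" using C assms by (simp add: dsize_plug trans_le_add1)
  ultimately show "\<exists>n \<ge> m. n \<in> {n. \<exists>t. valid t \<and> root t = M \<and> dsize t = n}" by blast
qed

lemma card_dsize_le:
  "\<exists>\<Gamma>. \<forall>m. card {t. valid t \<and> dsize t \<le> m} \<le> \<Gamma> ^ Suc (Suc m)"
proof -
  obtain \<Gamma>' where \<Gamma>': "card {t. valid t \<and> dsize t = n} \<le> \<Gamma>' ^ Suc n" for n using growth by blast
  \<comment> \<open>The base is raised to at least 2, so that one more factor absorbs the doubling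
    at each size.\<close>
  define \<Gamma> where "\<Gamma> = Suc (Suc \<Gamma>')"
  have \<Gamma>: "card {t. valid t \<and> dsize t = n} \<le> \<Gamma> ^ Suc n" for n
    using \<Gamma>'[of n] power_mono[of \<Gamma>' \<Gamma> "Suc n"] by (simp add: \<Gamma>_def)
  have "card {t. valid t \<and> dsize t \<le> m} \<le> \<Gamma> ^ Suc (Suc m)" for m
  proof (induction m)
    case 0
    have "\<Gamma> ^ Suc 0 \<le> \<Gamma> ^ Suc (Suc 0)" by (simp add: \<Gamma>_def)
    with \<Gamma>[of 0] have "card {t. valid t \<and> dsize t = 0} \<le> \<Gamma> ^ Suc (Suc 0)" by (rule le_trans)
    then show ?case by simp
  next
    case (Suc m)
    have "{t. valid t \<and> dsize t \<le> Suc m} = {t. valid t \<and> dsize t \<le> m} \<union> {t. valid t \<and> dsize t = Suc m}"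
      by auto
    then have "card {t. valid t \<and> dsize t \<le> Suc m} \<le> \<Gamma> ^ Suc (Suc m) + \<Gamma> ^ Suc (Suc m)"
      using card_Un_le Suc \<Gamma>[of "Suc m"] by (metis (no_types, lifting) add_mono le_trans)
    also have "\<dots> = 2 * \<Gamma> ^ Suc (Suc m)" by simp
    also have "\<dots> \<le> \<Gamma> * \<Gamma> ^ Suc (Suc m)" by (rule mult_le_mono1) (simp add: \<Gamma>_def)
    finally show ?case by simp
  qed
  then show ?thesis by blast
qed

text \<open>For fixed rules all thresholds and loop sizes are linear in \<open>zsize Z\<close>, so
  polynomial and exponential factors alike fit into a power of one base, independent of
  \<open>Z\<close>, \<open>N\<close> and \<open>n\<close>.\<close>

theorem not_containing_le:
  "\<exists>\<Theta> \<ge> 2. \<forall>Q \<in> V. \<forall>P \<in> V. \<forall>Z N n. zok Q P Z \<longrightarrow>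
     card {t. valid t \<and> root t = N \<and> dsize t = n \<and> \<not> contains Z t} * n \<le>
     card {t. valid t \<and> root t = N \<and> dsize t = n} * \<Theta> ^ Suc (zsize Z)"
proof -
  obtain a C where a: "0 < a" and C: "\<And>M. M \<in> V \<Longrightarrow> zok M M (C M) \<and> zsize (C M) = a"
    using exists_loops by blast
  obtain con where con: "\<And>M N. M \<in> V \<Longrightarrow> N \<in> V \<Longrightarrow> zok M N (con M N)" using conn by metis
  define c1 where "c1 = Max ((\<lambda>(M, N). zsize (con M N)) ` (V \<times> V))"
  have c1: "zsize (con M N) \<le> c1" if "M \<in> V" "N \<in> V" for M N
    unfolding c1_def using that finite_V by (intro Max_ge) auto
  obtain t0 where t0: "\<And>M. M \<in> V \<Longrightarrow> valid (t0 M) \<and> root (t0 M) = M" using inhabited by metis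
  define c0 where "c0 = Max ((\<lambda>M. dsize (t0 M)) ` V)"
  have c0: "dsize (t0 M) \<le> c0" if "M \<in> V" for M
    unfolding c0_def using that finite_V by (intro Max_ge) auto
  obtain \<Gamma> where \<Gamma>: "card {t. valid t \<and> dsize t \<le> m} \<le> \<Gamma> ^ Suc (Suc m)" for m using card_dsize_le by blast
  \<comment> \<open>\<open>replacement_exists\<close> asks for this size, with \<open>c1\<close>
    bounding the connecting paths; \<open>Suc\<close> makes it positive, as
    \<open>count_tops\<close> demands.\<close>
  define lo where "lo s = Suc (a * (s + 2 * c1))" for s
  define K where "K s = big (lo s) (card V * a)" for s
  define hi where "hi s = big_bound a (lo s)" for s
  define y where "y s = Suc (hi s) * a + c0" for s
  \<comment> \<open>A single linear quantity above the threshold \<open>K s\<close>, above the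
    linear factors of \<open>swap_count\<close> and above the exponent of \<Gamma>.\<close>
  define q where "q s = K s + 2 * hi s + Suc (card V * Suc (hi s + y s)) + Suc (hi s) + Suc (Suc (hi s + y s))" for s
  have "linearly_bounded q"
    unfolding q_def y_def hi_def K_def lo_def big_bound_def big_def
    by (intro linearly_bounded_intros)
  then obtain c where c: "q s \<le> c * Suc s" for s unfolding linearly_bounded_def by blast
  \<comment> \<open>Three linear factors, each at most \<open>2 ^ q s\<close>, produce the 8.
    \<open>Suc c\<close> keeps the exponent positive, so that \<Theta> is at least 2.\<close>
  define \<Theta> where "\<Theta> = (8 * Suc \<Gamma>) ^ Suc c"
  have pow_q: "(8 * Suc \<Gamma>) ^ q s \<le> \<Theta> ^ Suc s" for s
  proof -
    have "(8 * Suc \<Gamma>) ^ q s \<le> (8 * Suc \<Gamma>) ^ (Suc c * Suc s)"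
      using c[of s] by (intro power_increasing) auto
    then show ?thesis by (simp only: \<Theta>_def power_mult)
  qed
  have q_pow: "q s \<le> (8 * Suc \<Gamma>) ^ q s" for s
  proof -
    have "q s < 2 ^ q s" by (rule less_exp)
    also have "(2::nat) ^ q s \<le> (8 * Suc \<Gamma>) ^ q s" by (rule power_mono) auto
    finally show ?thesis by simp
  qed
  have main: "card {t. valid t \<and> root t = N \<and> dsize t = n \<and> \<not> contains Z t} * n \<le>
     card {t. valid t \<and> root t = N \<and> dsize t = n} * \<Theta> ^ Suc (zsize Z)"
    if QP: "Q \<in> V" "P \<in> V" and Z: "zok Q P Z" for Q P Z N n
  proof -
    define s where "s = zsize Z"
    define T where "T = {t. valid t \<and> root t = N \<and> dsize t = n}"
    define bad where "bad = {t \<in> T. \<not> contains Z t}"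
    have bad_eq: "{t. valid t \<and> root t = N \<and> dsize t = n \<and> \<not> contains Z t} = bad"
      by (auto simp: bad_def T_def)
    have "finite T" by (rule finite_subset[OF _ finite_dsize_le[of n]]) (auto simp: T_def)
    then have card_bad: "card bad \<le> card T" by (intro card_mono) (auto simp: bad_def)
    have "card bad * n \<le> card T * \<Theta> ^ Suc s"
    proof (cases "n \<le> K s")
      case True
      \<comment> \<open>Below the threshold no tops are guaranteed, but \<open>n\<close> itself is
        dominated by the power of \<Theta>.\<close>
      then have "n \<le> q s" by (simp add: q_def)
      then have "n \<le> \<Theta> ^ Suc s" using q_pow[of s] pow_q[of s] by linarith
      then show ?thesis using card_bad by (rule mult_le_mono[rotated])
    next
      case False
      have "\<exists>U. zok M M U \<and> zsize U = x \<and> (\<exists>A B. U = A @ Z @ B)"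
        if "M \<in> V" "a dvd x" "lo s \<le> x" for M x
      proof (rule replacement_exists[OF Z QP that(1)])
        show "\<And>M N. M \<in> V \<Longrightarrow> N \<in> V \<Longrightarrow> \<exists>X. zok M N X \<and> zsize X \<le> c1" using con c1 by blast
        show "zok M M (C M)" "zsize (C M) = a" using C that(1) by auto
        show "a * (zsize Z + 2 * c1) \<le> x" using that(3) by (simp add: lo_def s_def)
      qed (use a that in auto)
      then obtain rep where rep: "\<And>M x. M \<in> V \<Longrightarrow> a dvd x \<Longrightarrow> lo s \<le> x \<Longrightarrow>
          zok M M (rep M x) \<and> zsize (rep M x) = x \<and> (\<exists>A B. rep M x = A @ Z @ B)"
        by metis
      define tm where "tm M = plug (zpow (Suc (hi s)) (C M)) (t0 M)" for M
      have tm: "valid (tm M) \<and> root (tm M) = M \<and> hi s < dsize (tm M) \<and> dsize (tm M) \<le> y s"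
        if M: "M \<in> V" for M
      proof -
        have z: "zok M M (zpow (Suc (hi s)) (C M))" using C[OF M] zok_zpow by blast
        have d: "dsize (tm M) = Suc (hi s) * a + dsize (t0 M)"
          unfolding tm_def dsize_plug zsize_zpow using C[OF M] by simp
        have "hi s < Suc (hi s) * a" using a by (cases a) auto
        then have "hi s < dsize (tm M)" using d by linarith
        moreover have "dsize (tm M) \<le> y s" using c0[OF M] unfolding d y_def by simp
        moreover have "valid (tm M)" "root (tm M) = M" unfolding tm_def using zokD[OF z] t0[OF M] by auto
        ultimately show ?thesis by blast
      qed
      have A: "n \<le> 2 * hi s * ntops (is_top a (lo s) (hi s)) t" if "t \<in> bad" for t
      proof -
        have "valid t" "dsize t = n" using that by (auto simp: bad_def T_def)
        then show ?thesis using count_tops[of "lo s" a t] a False by (simp add: lo_def hi_def K_def)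
      qed
      from swap_count[OF rep tm T_def bad_def A]
      have "card bad * n \<le> 2 * hi s * (card T * Suc (card V * Suc (hi s + y s)) * Suc (hi s) *
          card {t. valid t \<and> dsize t \<le> hi s + y s})" .
      also have "\<dots> \<le> q s * (card T * q s * q s * Suc \<Gamma> ^ q s)"
      proof (intro mult_le_mono order.refl)
        show "2 * hi s \<le> q s" "Suc (card V * Suc (hi s + y s)) \<le> q s" "Suc (hi s) \<le> q s"
          unfolding q_def by linarith+
        have "card {t. valid t \<and> dsize t \<le> hi s + y s} \<le> \<Gamma> ^ Suc (Suc (hi s + y s))" by (rule \<Gamma>)
        also have "\<dots> \<le> Suc \<Gamma> ^ Suc (Suc (hi s + y s))" by (rule power_mono) auto
        also have "\<dots> \<le> Suc \<Gamma> ^ q s" unfolding q_def by (rule power_increasing) auto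
        finally show "card {t. valid t \<and> dsize t \<le> hi s + y s} \<le> Suc \<Gamma> ^ q s" .
      qed
      also have "\<dots> = card T * ((q s * q s * q s) * Suc \<Gamma> ^ q s)" by (simp only: ac_simps)
      also have "\<dots> \<le> card T * ((2 ^ q s * 2 ^ q s * 2 ^ q s) * Suc \<Gamma> ^ q s)"
        using less_exp[of "q s"] by (intro mult_le_mono order.refl) auto
      also have "\<dots> = card T * (8 * Suc \<Gamma>) ^ q s"
        unfolding power_mult_distrib[symmetric] by simp
      also have "\<dots> \<le> card T * \<Theta> ^ Suc s" using pow_q by (rule mult_le_mono2)
      finally show ?thesis .
    qed
    then show ?thesis unfolding bad_eq T_def[symmetric] s_def .
  qed
  have "(2::nat) \<le> 8 * Suc \<Gamma>" by simp
  also have "\<dots> \<le> \<Theta>" unfolding \<Theta>_def by (rule self_le_power) auto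
  finally have "2 \<le> \<Theta>" .
  with main show ?thesis by blast
qed

end

text \<open>The choice of \<open>p\<close> makes \<open>\<Theta> powr (c * p * log 2 n)\<close>
  equal to \<open>sqrt n\<close>, so the quotient is at most a constant over
  \<open>sqrt n\<close>.\<close>

lemma logarithmic_exponent_tendsto_0:
  fixes b T h :: "nat \<Rightarrow> nat" and \<Theta> c :: nat
  assumes \<Theta>: "2 \<le> \<Theta>" and c: "0 < c" and p: "p = 1 / (2 * real c * log 2 (real \<Theta>))"
    and h: "eventually (\<lambda>m. h m \<le> c * m) sequentially"
    and bT: "\<And>n. b n * n \<le> T n * \<Theta> ^ Suc (h (nat \<lceil>p * log 2 (real n)\<rceil>))"
  shows "(\<lambda>n. real (b n) / real (T n)) \<longlonglongrightarrow> 0"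
proof -
  let ?m = "\<lambda>n::nat. nat \<lceil>p * log 2 (real n)\<rceil>"
  have log\<Theta>: "0 < log 2 (real \<Theta>)" using \<Theta> by simp
  then have p0: "0 < p" using c by (simp add: p)
  \<comment> \<open>One factor \<Theta> comes from the \<open>Suc\<close> in the exponent, the other
    \<open>c\<close> from rounding up the logarithm.\<close>
  define k where "k = real \<Theta> ^ Suc c"
  \<comment> \<open>The bound on \<open>h\<close> holds only eventually, so it can be used at
    \<open>?m n\<close> only because this index tends to infinity.\<close>
  have "filterlim ?m sequentially sequentially"
  proof -
    have "filterlim (\<lambda>n::nat. p / ln 2 * ln (real n)) at_top sequentially"
      using p0 by (intro filterlim_tendsto_pos_mult_at_top[OF tendsto_const]
          filterlim_compose[OF ln_at_top] filterlim_real_sequentially) auto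
    then have "filterlim (\<lambda>n::nat. p * log 2 (real n)) at_top sequentially"
      by (simp add: log_def)
    then have ev: "eventually (\<lambda>n. real M \<le> p * log 2 (real n)) sequentially" for M
      by (simp add: filterlim_at_top)
    have "M \<le> ?m n" if "real M \<le> p * log 2 (real n)" for M n
      using that real_nat_ceiling_ge[of "p * log 2 (real n)"] by linarith
    then show ?thesis unfolding filterlim_at_top by (intro allI eventually_mono[OF ev])
  qed
  then have "eventually (\<lambda>n. h (?m n) \<le> c * ?m n) sequentially"
    using h by (rule eventually_compose_filterlim[rotated])
  then have "eventually (\<lambda>n. real (b n) / real (T n) \<le> k * (1 / sqrt (real n))) sequentially"
    using eventually_gt_at_top[of 0]
  proof eventually_elim
    case (elim n)
    have log: "0 \<le> log 2 (real n)" using elim by simp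
    have "0 \<le> p * log 2 (real n)" using p0 log by simp
    then have m: "real (?m n) \<le> p * log 2 (real n) + 1" by linarith
    have "real \<Theta> ^ Suc (h (?m n)) \<le> real \<Theta> ^ Suc (c * ?m n)"
      using elim \<Theta> by (intro power_increasing) auto
    also have "\<dots> = real \<Theta> powr (1 + real c * real (?m n))"
      using \<Theta> by (subst powr_realpow[symmetric]) auto
    also have "\<dots> \<le> real \<Theta> powr (1 + real c * (p * log 2 (real n) + 1))"
      using m \<Theta> by (intro powr_mono add_left_mono mult_left_mono) auto
    also have "\<dots> = k * real \<Theta> powr (real c * p * log 2 (real n))"
    proof -
      have "real \<Theta> powr (1 + real c * (p * log 2 (real n) + 1)) =
          real \<Theta> powr (real (Suc c) + real c * p * log 2 (real n))"
        by (simp add: algebra_simps)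
      also have "\<dots> = k * real \<Theta> powr (real c * p * log 2 (real n))"
        using \<Theta> unfolding powr_add k_def by (subst powr_realpow) auto
      finally show ?thesis .
    qed
    also have "real \<Theta> powr (real c * p * log 2 (real n)) = sqrt (real n)"
    proof -
      have "log 2 (real \<Theta>) * (real c * p * log 2 (real n)) = log 2 (real n) * (1 / 2)"
        using log\<Theta> c by (simp add: p field_simps)
      moreover have "real \<Theta> = 2 powr log 2 (real \<Theta>)" using \<Theta> by simp
      ultimately have "real \<Theta> powr (real c * p * log 2 (real n)) = 2 powr (log 2 (real n) * (1 / 2))"
        by (metis powr_powr)
      also have "\<dots> = real n powr (1 / 2)" using elim unfolding powr_powr[symmetric] by simp
      finally show ?thesis by (simp add: powr_half_sqrt)
    qed
    finally have \<Theta>n: "real \<Theta> ^ Suc (h (?m n)) \<le> k * sqrt (real n)" .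
    have "real (b n) * real n = real (b n * n)" by simp
    also have "\<dots> \<le> real (T n * \<Theta> ^ Suc (h (?m n)))" using bT[of n] by (rule of_nat_mono)
    also have "\<dots> = real (T n) * real \<Theta> ^ Suc (h (?m n))" by simp
    also have "\<dots> \<le> real (T n) * (k * sqrt (real n))" using \<Theta>n by (intro mult_left_mono) auto
    finally have *: "real (b n) * real n \<le> real (T n) * (k * sqrt (real n))" .
    have n: "real n = sqrt (real n) * sqrt (real n)" by simp
    have "real (b n) * sqrt (real n) * sqrt (real n) \<le> real (T n) * k * sqrt (real n)"
      using * n by (simp add: mult.assoc)
    then have "real (b n) * sqrt (real n) \<le> real (T n) * k"
      using elim by (simp add: mult_le_cancel_right)
    then have "real (b n) \<le> real (T n) * (k * (1 / sqrt (real n)))"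
      using elim by (simp add: field_simps)
    moreover have "0 \<le> k * (1 / sqrt (real n))" by (simp add: k_def)
    \<comment> \<open>For \<open>T n = 0\<close> the quotient is 0 by the convention for
      division.\<close>
    ultimately show ?case
      by (cases "T n = 0") (auto simp: divide_le_eq mult.commute)
  qed
  then show ?thesis
  proof (rule tendsto_sandwich[where f = "\<lambda>_. 0", rotated])
    show "(\<lambda>n. k * (1 / sqrt (real n))) \<longlonglongrightarrow> 0"
      by (intro tendsto_mult_right_zero real_tendsto_divide_at_top[OF tendsto_const]
          filterlim_compose[OF sqrt_at_top] filterlim_real_sequentially)
  qed simp_all
qed

section \<open>Contexts and their holes\<close>

text \<open>\<open>fill\<close> and \<open>fill_list\<close> are mutually recursive over a nested
  datatype; this rule proves statements about both at once.\<close>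

lemma ctxt_pair_induct [case_names Hole Node Nil Cons]:
  assumes "P Hole" "\<And>a Cs. Q Cs \<Longrightarrow> P (Node a Cs)"
    and "Q []" "\<And>C Cs. P C \<Longrightarrow> Q Cs \<Longrightarrow> Q (C # Cs)"
  shows "P C" "Q Cs"
proof -
  show P: "P C" for C
  proof (induction C)
    case (Node a Cs)
    then have "Q Cs" by (induction Cs) (use assms in auto)
    then show ?case by (rule assms)
  qed (rule assms)
  show "Q Cs" by (induction Cs) (use assms P in auto)
qed

lemma length_fill_list [simp]: "length (fill_list Cs Ds) = length Cs"
  by (induction Cs arbitrary: Ds) auto

lemma csize_fill:
  "length Ds = hn C \<Longrightarrow> csize (fill C Ds) = csize C + sum_list (map csize Ds)"
  "length Ds = sum_list (map hn Cs) \<Longrightarrow>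
     sum_list (map csize (fill_list Cs Ds)) = sum_list (map csize Cs) + sum_list (map csize Ds)"
proof (induction C and Cs arbitrary: Ds and Ds rule: ctxt_pair_induct)
  case Hole
  then show ?case by (cases Ds) auto
next
  case (Cons C Cs)
  have "sum_list (map csize Ds) = sum_list (map csize (take (hn C) Ds)) + sum_list (map csize (drop (hn C) Ds))"
    by (metis append_take_drop_id map_append sum_list.append)
  with Cons show ?case by simp
qed auto

lemma hn_fill:
  "length Ds = hn C \<Longrightarrow> hn (fill C Ds) = sum_list (map hn Ds)"
  "length Ds = sum_list (map hn Cs) \<Longrightarrow> sum_list (map hn (fill_list Cs Ds)) = sum_list (map hn Ds)"
proof (induction C and Cs arbitrary: Ds and Ds rule: ctxt_pair_induct)
  case Hole
  then show ?case by (cases Ds) auto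
next
  case (Cons C Cs)
  have "sum_list (map hn Ds) = sum_list (map hn (take (hn C) Ds)) + sum_list (map hn (drop (hn C) Ds))"
    by (metis append_take_drop_id map_append sum_list.append)
  with Cons show ?case by simp
qed auto

lemma is_context_fill:
  "is_context \<Sigma> C \<Longrightarrow> length Ds = hn C \<Longrightarrow> list_all (is_context \<Sigma>) Ds \<Longrightarrow> is_context \<Sigma> (fill C Ds)"
  "list_all (is_context \<Sigma>) Cs \<Longrightarrow> length Ds = sum_list (map hn Cs) \<Longrightarrow> list_all (is_context \<Sigma>) Ds \<Longrightarrow>
     list_all (is_context \<Sigma>) (fill_list Cs Ds)"
proof (induction C and Cs arbitrary: Ds and Ds rule: ctxt_pair_induct)
  case Hole
  then show ?case by (cases Ds) auto
next
  case (Cons C Cs)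
  have "list_all (is_context \<Sigma>) (take (hn C) Ds)" "list_all (is_context \<Sigma>) (drop (hn C) Ds)"
    using Cons.prems(3) by (auto simp: list_all_iff dest: in_set_takeD in_set_dropD)
  with Cons show ?case by simp
qed auto

lemma fill_list_append:
  "fill_list (As @ Bs) Xs =
     fill_list As (take (sum_list (map hn As)) Xs) @ fill_list Bs (drop (sum_list (map hn As)) Xs)"
proof (induction As arbitrary: Xs)
  case (Cons A As)
  then show ?case by (simp add: min_def drop_take add.commute)
qed simp

lemma fill_fill:
  "length Ds = hn C \<Longrightarrow> length Xs = sum_list (map hn Ds) \<Longrightarrow> fill (fill C Ds) Xs = fill C (fill_list Ds Xs)"
  "length Ds = sum_list (map hn Cs) \<Longrightarrow> length Xs = sum_list (map hn Ds) \<Longrightarrow>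
     fill_list (fill_list Cs Ds) Xs = fill_list Cs (fill_list Ds Xs)"
proof (induction C and Cs arbitrary: Ds Xs and Ds Xs rule: ctxt_pair_induct)
  case Hole
  then obtain D where "Ds = [D]" by (cases Ds) auto
  with Hole show ?case by simp
next
  case (Cons C Cs)
  define As Bs where "As = take (hn C) Ds" and "Bs = drop (hn C) Ds"
  have Ds: "Ds = As @ Bs" by (simp add: As_def Bs_def)
  have len: "length As = hn C" "length Bs = sum_list (map hn Cs)"
    using Cons.prems(1) by (auto simp: As_def Bs_def)
  let ?k = "sum_list (map hn As)"
  have hn: "hn (fill C As) = ?k" using hn_fill(1) len(1) by blast
  have Xs: "length (take ?k Xs) = sum_list (map hn As)" "length (drop ?k Xs) = sum_list (map hn Bs)"
    using Cons.prems(2) by (auto simp: Ds)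
  have "fill_list (fill_list (C # Cs) Ds) Xs =
      fill (fill C As) (take ?k Xs) # fill_list (fill_list Cs Bs) (drop ?k Xs)"
    by (simp add: As_def[symmetric] Bs_def[symmetric] hn)
  also have "\<dots> = fill C (fill_list As (take ?k Xs)) # fill_list Cs (fill_list Bs (drop ?k Xs))"
    using Cons.IH(1)[OF len(1) Xs(1)] Cons.IH(2)[OF len(2) Xs(2)] by simp
  also have "\<dots> = fill_list (C # Cs) (fill_list Ds Xs)"
    unfolding Ds fill_list_append by (simp add: len(1))
  finally show ?case .
qed auto

lemma fill_id:
  fixes C :: "'a ctxt" and Cs :: "'a ctxt list"
  shows "fill C (replicate (hn C) Hole) = C"
  "fill_list Cs (replicate (sum_list (map hn Cs)) Hole) = Cs"
  by (induction C and Cs rule: ctxt_pair_induct) (auto simp: take_replicate drop_replicate min_def)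

lemma fill_Nil: "hn C = 0 \<Longrightarrow> fill C [] = C"
  using fill_id(1)[of C] by simp

lemma fill_inject:
  "length Ds = hn C \<Longrightarrow> length Es = hn C \<Longrightarrow> fill C Ds = fill C Es \<Longrightarrow> Ds = Es"
  "length Ds = sum_list (map hn Cs) \<Longrightarrow> length Es = sum_list (map hn Cs) \<Longrightarrow>
     fill_list Cs Ds = fill_list Cs Es \<Longrightarrow> Ds = Es"
proof (induction C and Cs arbitrary: Ds Es and Ds Es rule: ctxt_pair_induct)
  case Hole
  then show ?case by (cases Ds; cases Es) auto
next
  case (Cons C Cs)
  then have "take (hn C) Ds = take (hn C) Es" "drop (hn C) Ds = drop (hn C) Es" by simp_all
  then show ?case by (metis append_take_drop_id)
qed auto

lemma fill_list_one_hole: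
  assumes "sum_list (map hn As) = 0" "hn B = 1" "sum_list (map hn Bs) = 0"
  shows "fill_list (As @ B # Bs) [X] = As @ fill B [X] # Bs"
proof -
  have "fill_list As [] = As" "fill_list Bs [] = Bs"
    using fill_id(2)[of As, unfolded assms(1)] fill_id(2)[of Bs, unfolded assms(3)] by simp_all
  with assms show ?thesis unfolding fill_list_append by (simp del: sum_list_eq_0_iff)
qed

section \<open>Recovering a context and its nonterminals from a sentential form\<close>

lemma hn_emb [simp]: "hn (emb C) = hn C"
  by (induction C) (simp_all add: comp_def cong: map_cong)

text \<open>Undoes \<open>emb\<close> while putting \<open>X\<close> for every nonterminal:
  \<open>X = Hole\<close> recovers the context of a rule, a tree \<open>X\<close> yields the tree
  obtained from a derived context.\<close>

primrec nsub :: "'a ctxt \<Rightarrow> ('a + 'n) ctxt \<Rightarrow> 'a ctxt" where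
  "nsub X Hole = Hole"
| "nsub X (Node s Vs) = (case s of Inl a \<Rightarrow> Node a (map (nsub X) Vs) | Inr N \<Rightarrow> X)"

primrec ntlist :: "('a + 'n) ctxt \<Rightarrow> 'n list" where
  "ntlist Hole = []"
| "ntlist (Node s Vs) = (case s of Inl a \<Rightarrow> concat (map ntlist Vs) | Inr N \<Rightarrow> [N])"

lemma nsub_fill:
  fixes C :: "'a ctxt" and Cs :: "'a ctxt list" and Vs :: "('a + 'n) ctxt list"
  shows "length Vs = hn C \<Longrightarrow> nsub X (fill (emb C) Vs) = fill C (map (nsub X) Vs)"
  "length Vs = sum_list (map hn Cs) \<Longrightarrow>
     map (nsub X) (fill_list (map emb Cs) Vs) = fill_list Cs (map (nsub X) Vs)"
proof (induction C and Cs arbitrary: Vs and Vs rule: ctxt_pair_induct)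
  case Hole
  then show ?case by (cases Vs) auto
qed (auto simp: take_map drop_map)

lemma ntlist_fill:
  fixes C :: "'a ctxt" and Cs :: "'a ctxt list" and Vs :: "('a + 'n) ctxt list"
  shows "length Vs = hn C \<Longrightarrow> ntlist (fill (emb C) Vs) = concat (map ntlist Vs)"
  "length Vs = sum_list (map hn Cs) \<Longrightarrow>
     concat (map ntlist (fill_list (map emb Cs) Vs)) = concat (map ntlist Vs)"
proof (induction C and Cs arbitrary: Vs and Vs rule: ctxt_pair_induct)
  case Hole
  then show ?case by (cases Vs) auto
next
  case (Cons C Cs)
  have "concat (map ntlist Vs) =
      concat (map ntlist (take (hn C) Vs)) @ concat (map ntlist (drop (hn C) Vs))"
    by (metis append_take_drop_id concat_append map_append)
  with Cons show ?case by simp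
qed auto

lemma concat_map_NT: "concat (map ntlist (map NT Ns)) = Ns"
  by (induction Ns) auto

lemma fill_NT_inject:
  fixes C C' :: "'a ctxt" and Ns Ns' :: "'n list"
  assumes "length Ns = hn C" "length Ns' = hn C'"
    and eq: "fill (emb C) (map NT Ns) = fill (emb C') (map NT Ns')"
  shows "C = C' \<and> Ns = Ns'"
proof
  have "nsub Hole (fill (emb D) (map NT Ms)) = D" if "length Ms = hn D" for D :: "'a ctxt" and Ms :: "'n list"
  proof -
    have "map (nsub Hole) (map NT Ms) = replicate (hn D) (Hole :: 'a ctxt)"
      unfolding that[symmetric] by (induction Ms) auto
    then show ?thesis using that nsub_fill(1)[of "map NT Ms" D Hole] fill_id(1)[of D] by simp
  qed
  then show "C = C'" using assms by metis
  have "ntlist (fill (emb D) (map NT Ms)) = Ms" if "length Ms = hn D" for D :: "'a ctxt" and Ms :: "'n list"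
    using that ntlist_fill(1)[of "map NT Ms" D, unfolded concat_map_NT] by simp
  then show "Ns = Ns'" using assms by metis
qed

section \<open>Counting trees by their preorder words\<close>

primrec preorder :: "'a ctxt \<Rightarrow> 'a list" where
  "preorder Hole = []"
| "preorder (Node a Cs) = a # concat (map preorder Cs)"

lemma length_preorder:
  fixes C :: "'a ctxt" and Cs :: "'a ctxt list"
  shows "length (preorder C) = csize C"
  "length (concat (map preorder Cs)) = sum_list (map csize Cs)"
  by (induction C and Cs rule: ctxt_pair_induct) auto

lemma set_preorder:
  fixes C :: "'a ctxt" and Cs :: "'a ctxt list"
  shows "is_context \<Sigma> C \<Longrightarrow> set (preorder C) \<subseteq> dom \<Sigma>"
  "list_all (is_context \<Sigma>) Cs \<Longrightarrow> set (concat (map preorder Cs)) \<subseteq> dom \<Sigma>"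
  by (induction C and Cs rule: ctxt_pair_induct) auto

text \<open>Polish notation: with fixed ranks no preorder word of a tree is a proper prefix of
  another. The remainders \<open>xs\<close> and \<open>ys\<close> carry this through the
  induction.\<close>

lemma preorder_inject:
  "is_context \<Sigma> C \<Longrightarrow> hn C = 0 \<Longrightarrow> is_context \<Sigma> D \<Longrightarrow> hn D = 0 \<Longrightarrow>
     preorder C @ xs = preorder D @ ys \<Longrightarrow> C = D \<and> xs = ys"
  "list_all (is_context \<Sigma>) Cs \<Longrightarrow> sum_list (map hn Cs) = 0 \<Longrightarrow>
     list_all (is_context \<Sigma>) Ds \<Longrightarrow> sum_list (map hn Ds) = 0 \<Longrightarrow> length Cs = length Ds \<Longrightarrow>
     concat (map preorder Cs) @ xs = concat (map preorder Ds) @ ys \<Longrightarrow> Cs = Ds \<and> xs = ys"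
proof (induction C and Cs arbitrary: D xs ys and Ds xs ys rule: ctxt_pair_induct)
  case (Node a Cs)
  then obtain Ds where D: "D = Node a Ds" by (cases D) auto
  with Node.prems have "length Cs = length Ds" by simp
  with Node D show ?case by auto
next
  case (Cons C Cs)
  then obtain D Ds' where Ds: "Ds = D # Ds'" by (cases Ds) auto
  from Cons.prems Ds have "C = D \<and> concat (map preorder Cs) @ xs = concat (map preorder Ds') @ ys"
    by (intro Cons.IH(1)) auto
  then show ?case using Cons.IH(2)[of Ds' xs ys] Cons.prems Ds by simp
qed auto

lemma card_trees_of_size:
  assumes "finite (dom \<Sigma>)"
  shows "finite {T \<in> trees \<Sigma>. csize T = n} \<and> card {T \<in> trees \<Sigma>. csize T = n} \<le> card (dom \<Sigma>) ^ n"
proof -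
  let ?L = "{xs. set xs \<subseteq> dom \<Sigma> \<and> length xs = n}"
  have fin: "finite ?L" using assms by (rule finite_lists_length_eq)
  have sub: "preorder ` {T \<in> trees \<Sigma>. csize T = n} \<subseteq> ?L"
    using set_preorder(1) length_preorder(1) by (fastforce simp: trees_def contexts_def)
  have inj: "inj_on preorder {T \<in> trees \<Sigma>. csize T = n}"
    by (rule inj_onI) (use preorder_inject(1)[of \<Sigma> _ _ "[]" "[]"] in \<open>auto simp: trees_def contexts_def\<close>)
  have "finite {T \<in> trees \<Sigma>. csize T = n}" using inj_on_finite[OF inj sub fin] .
  moreover have "card {T \<in> trees \<Sigma>. csize T = n} \<le> card ?L" using card_inj_on_le[OF inj sub fin] .
  ultimately show ?thesis using card_lists_length_eq[OF assms] by simp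
qed

section \<open>Derivations of regular tree grammars\<close>

primrec yield :: "('n \<times> 'a ctxt \<times> 'n list) deriv \<Rightarrow> 'a ctxt" where
  "yield (Der \<rho> ts) = fill (fst (snd \<rho>)) (map yield ts)"

locale tree_grammar =
  fixes G :: "('a, 'n) grammar"
  assumes regular: "regular_tree_grammar G"
begin

sublocale weighted_rules "rules G" fst "\<lambda>\<rho>. snd (snd \<rho>)" "\<lambda>\<rho>. csize (fst (snd \<rho>))" "nonterms G" .

lemma rulesD:
  assumes "(N, C, Ns) \<in> rules G"
  shows "N \<in> nonterms G" "is_context (terminals G) C" "length Ns = hn C" "set Ns \<subseteq> nonterms G"
  using regular assms by (auto simp: regular_tree_grammar_def contexts_def)

lemma root_nonterms: "valid t \<Longrightarrow> root t \<in> nonterms G"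
  using rulesD(1) by (cases t) (metis prod.collapse root.simps valid.simps)

lemma valid_length: "valid (Der (N, C, Ns) ts) \<Longrightarrow> length ts = hn C"
  using rulesD(3) by (metis length_map snd_conv valid.simps)

lemma yield_tree:
  "valid t \<Longrightarrow> is_context (terminals G) (yield t) \<and> hn (yield t) = 0 \<and> csize (yield t) = dsize t"
proof (induction t)
  case (Der \<rho> ts)
  obtain N C Ns where \<rho>: "\<rho> = (N, C, Ns)" by (cases \<rho>)
  have len: "length (map yield ts) = hn C" using valid_length[of N C Ns ts] Der.prems \<rho> by (simp del: valid.simps)
  have IH: "is_context (terminals G) (yield t) \<and> hn (yield t) = 0 \<and> csize (yield t) = dsize t"
    if "t \<in> set ts" for t using Der that by (auto simp: list_all_iff)
  have "is_context (terminals G) C" using Der.prems rulesD(2) \<rho> by auto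
  then have "is_context (terminals G) (yield (Der \<rho> ts))"
    using is_context_fill(1)[OF _ len] IH by (simp add: \<rho> list_all_iff)
  moreover have "hn (yield (Der \<rho> ts)) = 0"
    using hn_fill(1)[OF len] IH by (simp add: \<rho>)
  moreover have "sum_list (map (csize \<circ> yield) ts) = sum_list (map dsize ts)"
    using IH by (intro arg_cong[of _ _ sum_list] map_cong) auto
  then have "csize (yield (Der \<rho> ts)) = dsize (Der \<rho> ts)"
    using csize_fill(1)[OF len] by (simp add: \<rho>)
  ultimately show ?case by blast
qed

lemma yield_in_trees: "valid t \<Longrightarrow> yield t \<in> trees (terminals G)"
  using yield_tree by (simp add: trees_def contexts_def)

text \<open>Root and yield determine the derivation; the yield contributes one symbol per unit of
  size and the root one further factor.\<close>

lemma growth: "\<exists>\<Gamma>. \<forall>n. finite {t. valid t \<and> dsize t = n} \<and>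
    card {t. valid t \<and> dsize t = n} \<le> \<Gamma> ^ Suc n"
  if inj: "\<And>t t'. valid t \<Longrightarrow> valid t' \<Longrightarrow> root t = root t' \<Longrightarrow> yield t = yield t' \<Longrightarrow> t = t'"
proof -
  let ?\<Sigma> = "terminals G"
  let ?\<Gamma> = "card (nonterms G) + card (dom ?\<Sigma>)"
  have fin: "finite (dom ?\<Sigma>)" "finite (nonterms G)"
    using regular by (auto simp: regular_tree_grammar_def)
  have "finite {t. valid t \<and> dsize t = n} \<and> card {t. valid t \<and> dsize t = n} \<le> ?\<Gamma> ^ Suc n" for n
  proof -
    let ?A = "{t. valid t \<and> dsize t = n}" and ?B = "nonterms G \<times> {T \<in> trees ?\<Sigma>. csize T = n}"
    note T = card_trees_of_size[OF fin(1), of n]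
    have inj_on: "inj_on (\<lambda>t. (root t, yield t)) ?A" using inj by (auto simp: inj_on_def)
    have sub: "(\<lambda>t. (root t, yield t)) ` ?A \<subseteq> ?B"
      using yield_tree yield_in_trees root_nonterms by auto
    have finB: "finite ?B" using T fin by auto
    have "card ?B \<le> ?\<Gamma> * ?\<Gamma> ^ n"
      unfolding card_cartesian_product
      using T power_mono[of "card (dom ?\<Sigma>)" ?\<Gamma> n] by (intro mult_le_mono) auto
    then show ?thesis
      using inj_on_finite[OF inj_on sub finB] card_inj_on_le[OF inj_on sub finB] by simp
  qed
  then show ?thesis by blast
qed

section \<open>Leftmost rewriting and the consequences of unambiguity\<close>

abbreviation leftmost_steps :: "('a + 'n) ctxt \<Rightarrow> ('a + 'n) ctxt \<Rightarrow> bool" where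
  "leftmost_steps \<equiv> (leftmost_step G)\<^sup>*\<^sup>*"

lemma leftmost_steps_child:
  assumes "leftmost_steps T T'" "\<forall>U \<in> set Ts. set_ctxt U \<inter> range Inr = {}"
  shows "leftmost_steps (Node (Inl a) (Ts @ T # Us)) (Node (Inl a) (Ts @ T' # Us))"
  using assms(1)
proof induction
  case (step U U')
  from step.hyps(2) have "leftmost_step G (Node (Inl a) (Ts @ U # Us)) (Node (Inl a) (Ts @ U' # Us))"
    using assms(2) by (rule leftmost_child)
  with step.IH show ?case by (rule rtranclp.rtrancl_into_rtrancl)
qed simp

text \<open>In the second claim \<open>As\<close> collects the children already completed. They
  contain no nonterminals, so rewriting in the next child is leftmost.\<close>

lemma leftmost_steps_fill:
  fixes C :: "'a ctxt" and Cs :: "'a ctxt list"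
  shows "length Ns = hn C \<Longrightarrow> list_all2 (\<lambda>N T. leftmost_steps (NT N) (emb T)) Ns Ts \<Longrightarrow>
      leftmost_steps (fill (emb C) (map NT Ns)) (emb (fill C Ts))"
    and "length Ns = sum_list (map hn Cs) \<Longrightarrow> list_all2 (\<lambda>N T. leftmost_steps (NT N) (emb T)) Ns Ts \<Longrightarrow>
      leftmost_steps (Node (Inl a) (map emb As @ fill_list (map emb Cs) (map NT Ns)))
        (Node (Inl a) (map emb (As @ fill_list Cs Ts)))"
proof (induction C and Cs arbitrary: Ns Ts and Ns Ts a As rule: ctxt_pair_induct)
  case Hole
  then show ?case by (cases Ns) (auto simp: list_all2_Cons1)
next
  case (Node a Cs)
  then show ?case using Node.IH[of Ns Ts a "[]"] by simp
next
  case (Cons C Cs)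
  let ?k = "hn C"
  have all: "list_all2 (\<lambda>N T. leftmost_steps (NT N) (emb T)) (take ?k Ns) (take ?k Ts)"
     "list_all2 (\<lambda>N T. leftmost_steps (NT N) (emb T)) (drop ?k Ns) (drop ?k Ts)"
    using Cons.prems(2) by (auto intro: list_all2_takeI list_all2_dropI)
  let ?T = "fill (emb C) (map NT (take ?k Ns))" and ?T' = "emb (fill C (take ?k Ts))"
  let ?Us = "fill_list (map emb Cs) (map NT (drop ?k Ns))"
  have "leftmost_steps ?T ?T'"
    using Cons.prems(1) all(1) by (intro Cons.IH(1)) auto
  then have "leftmost_steps (Node (Inl a) (map emb As @ ?T # ?Us)) (Node (Inl a) (map emb As @ ?T' # ?Us))"
    by (rule leftmost_steps_child) (auto simp: ctxt.set_map)
  also have "leftmost_steps (Node (Inl a) (map emb As @ ?T' # ?Us))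
      (Node (Inl a) (map emb ((As @ [fill C (take ?k Ts)]) @ fill_list Cs (drop ?k Ts))))"
    using Cons.IH(2)[of "drop ?k Ns" "drop ?k Ts" a "As @ [fill C (take ?k Ts)]"] Cons.prems(1) all(2)
    by simp
  finally show ?case by (simp add: take_map drop_map)
qed auto

text \<open>The second form starts after the first rule; it allows a leftmost sequence to be
  assembled whose second entry is known.\<close>

lemma leftmost_steps_yield: "valid t \<Longrightarrow> leftmost_steps (NT (root t)) (emb (yield t))"
  and leftmost_steps_yield':
    "valid (Der (N, C, Ns) ts) \<Longrightarrow>
       leftmost_steps (fill (emb C) (map NT Ns)) (emb (yield (Der (N, C, Ns) ts)))"
proof -
  have *: "leftmost_steps (fill (emb C) (map NT Ns)) (emb (yield (Der (N, C, Ns) ts)))"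
    if v: "valid (Der (N, C, Ns) ts)"
      and IH: "\<And>t. t \<in> set ts \<Longrightarrow> valid t \<Longrightarrow> leftmost_steps (NT (root t)) (emb (yield t))"
    for N C Ns ts
  proof -
    have "list_all2 (\<lambda>N T. leftmost_steps (NT N) (emb T)) (map root ts) (map yield ts)"
      using v IH by (auto simp: list.rel_map list_all_iff intro!: list.rel_refl_strong)
    then show ?thesis
      using leftmost_steps_fill(1)[of Ns C "map yield ts"] v rulesD(3)[of N C Ns] by simp
  qed
  show steps: "leftmost_steps (NT (root t)) (emb (yield t))" if "valid t" for t
    using that
  proof (induction t)
    case (Der \<rho> ts)
    obtain N C Ns where \<rho>: "\<rho> = (N, C, Ns)" by (cases \<rho>)
    have "leftmost_step G (NT N) (fill (emb C) (map NT Ns))"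
      using Der.prems \<rho> by (intro leftmost_root) auto
    moreover have "leftmost_steps (fill (emb C) (map NT Ns)) (emb (yield (Der \<rho> ts)))"
      using *[of N C Ns ts] Der \<rho> by blast
    ultimately show ?case by (simp add: \<rho> converse_rtranclp_into_rtranclp)
  qed
  show "valid (Der (N, C, Ns) ts) \<Longrightarrow>
       leftmost_steps (fill (emb C) (map NT Ns)) (emb (yield (Der (N, C, Ns) ts)))"
    using * steps by blast
qed

lemma leftmost_seq_exists: "leftmost_steps T T' \<Longrightarrow> \<exists>ts. leftmost_seq G T T' ts"
proof (induction rule: converse_rtranclp_induct)
  case base
  then show ?case by (intro exI[of _ "[T']"]) (simp add: leftmost_seq_def)
next
  case (step T U)
  then obtain ts where "leftmost_seq G U T' ts" by blast
  with step.hyps(1) have "leftmost_seq G T T' (T # ts)"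
    by (cases ts) (auto simp: leftmost_seq_def)
  then show ?case by blast
qed

text \<open>Both derivations give leftmost sequences from one nonterminal to one tree. Equality of
  the sequences forces equal second entries, which reveal the first rule; filling is injective, so
  the argument recurses into the children.\<close>

lemma yield_inject:
  assumes unamb: "unambiguous G"
  shows "valid t \<Longrightarrow> valid t' \<Longrightarrow> root t = root t' \<Longrightarrow> yield t = yield t' \<Longrightarrow> t = t'"
proof (induction t arbitrary: t')
  case (Der \<rho> ts)
  obtain N C Ns where \<rho>: "\<rho> = (N, C, Ns)" by (cases \<rho>)
  obtain N' C' Ns' ts' where t': "t' = Der (N', C', Ns') ts'" by (metis deriv.exhaust prod_cases3)
  with Der.prems \<rho> have N': "N' = N" by simp
  let ?t = "Der (N, C, Ns) ts" and ?t' = "Der (N, C', Ns') ts'"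
  have v: "valid ?t" "valid ?t'" "yield ?t = yield ?t'" using Der.prems \<rho> t' N' by auto
  have rule: "(N, C, Ns) \<in> rules G" "(N, C', Ns') \<in> rules G" using v by auto
  obtain qs where qs: "leftmost_seq G (fill (emb C) (map NT Ns)) (emb (yield ?t)) qs"
    using leftmost_seq_exists[OF leftmost_steps_yield'[OF v(1)]] by blast
  obtain qs' where qs': "leftmost_seq G (fill (emb C') (map NT Ns')) (emb (yield ?t')) qs'"
    using leftmost_seq_exists[OF leftmost_steps_yield'[OF v(2)]] by blast
  have "leftmost_seq G (NT N) (emb (yield ?t)) (NT N # qs)"
    using qs leftmost_root[OF rule(1)] by (cases qs) (auto simp: leftmost_seq_def)
  moreover have "leftmost_seq G (NT N) (emb (yield ?t)) (NT N # qs')"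
    using qs' leftmost_root[OF rule(2)] v(3) by (cases qs') (auto simp: leftmost_seq_def)
  ultimately have "qs = qs'"
    using unamb rulesD(1)[OF rule(1)] yield_in_trees[OF v(1)] unfolding unambiguous_def by blast
  then have "fill (emb C) (map NT Ns) = fill (emb C') (map NT Ns')"
    using qs qs' by (auto simp: leftmost_seq_def)
  then have eq: "C = C'" "Ns = Ns'"
    using fill_NT_inject rulesD(3)[OF rule(1)] rulesD(3)[OF rule(2)] by blast+
  have "length ts = hn C" "length ts' = hn C" using v valid_length eq by blast+
  then have y: "map yield ts = map yield ts'"
    using v(3) eq fill_inject(1)[of "map yield ts" C "map yield ts'"] by simp
  have r: "map root ts = map root ts'" using v eq by auto
  have "ts = ts'"
  proof (rule nth_equalityI)
    show len: "length ts = length ts'" using y map_eq_imp_length_eq by blast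
    fix i assume i: "i < length ts"
    then have "root (ts ! i) = root (ts' ! i)" "yield (ts ! i) = yield (ts' ! i)"
      using y r len by (metis nth_map)+
    moreover have "valid (ts ! i)" "valid (ts' ! i)" using v i len by (auto simp: list_all_length)
    ultimately show "ts ! i = ts' ! i" using Der.IH[of "ts ! i" "ts' ! i"] i by simp
  qed
  with eq N' \<rho> t' show ?case by simp
qed

text \<open>Nonterminals may be left unrewritten, which also covers the derivations of contexts.\<close>

inductive bigstep :: "'n \<Rightarrow> ('a + 'n) ctxt \<Rightarrow> bool" where
  bigstep_NT: "bigstep N (NT N)"
| bigstep_rule: "(N, C, Ns) \<in> rules G \<Longrightarrow> list_all2 bigstep Ns Vs \<Longrightarrow> bigstep N (fill (emb C) Vs)"

text \<open>Extends \<open>bigstep\<close> to sentential forms, which rewriting sequences pass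
  through.\<close>

inductive bigsteps :: "('a + 'n) ctxt \<Rightarrow> ('a + 'n) ctxt \<Rightarrow> bool" where
  bigsteps_NT: "bigstep N V \<Longrightarrow> bigsteps (NT N) V"
| bigsteps_Node: "list_all2 bigsteps Us Vs \<Longrightarrow> bigsteps (Node (Inl a) Us) (Node (Inl a) Vs)"

inductive_cases bigsteps_NT_E: "bigsteps (NT N) V"
inductive_cases bigsteps_Node_E: "bigsteps (Node (Inl a) Us) V"

lemma bigsteps_fillD:
  fixes C :: "'a ctxt" and Cs :: "'a ctxt list"
  shows "length Ns = hn C \<Longrightarrow> bigsteps (fill (emb C) (map NT Ns)) V \<Longrightarrow>
      \<exists>Vs. list_all2 bigstep Ns Vs \<and> V = fill (emb C) Vs"
    and "length Ns = sum_list (map hn Cs) \<Longrightarrow> list_all2 bigsteps (fill_list (map emb Cs) (map NT Ns)) Ws \<Longrightarrow>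
      \<exists>Vs. list_all2 bigstep Ns Vs \<and> Ws = fill_list (map emb Cs) Vs"
proof (induction C and Cs arbitrary: Ns V and Ns Ws rule: ctxt_pair_induct)
  case Hole
  then obtain N where "Ns = [N]" by (cases Ns) auto
  with Hole show ?case by (intro exI[of _ "[V]"]) (auto elim: bigsteps_NT_E)
next
  case (Node a Cs)
  from Node.prems(2) obtain Ws where "V = Node (Inl a) Ws"
    "list_all2 bigsteps (fill_list (map emb Cs) (map NT Ns)) Ws"
    by (auto elim: bigsteps_Node_E)
  with Node.IH[of Ns Ws] Node.prems(1) show ?case by auto
next
  case Nil
  then show ?case by auto
next
  case (Cons C Cs)
  let ?k = "hn C"
  from Cons.prems(2) obtain W Ws' where W: "Ws = W # Ws'"
    "bigsteps (fill (emb C) (map NT (take ?k Ns))) W"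
    "list_all2 bigsteps (fill_list (map emb Cs) (map NT (drop ?k Ns))) Ws'"
    by (auto simp: list_all2_Cons1 take_map drop_map)
  obtain Vs where Vs: "list_all2 bigstep (take ?k Ns) Vs" "W = fill (emb C) Vs"
    using Cons.IH(1)[OF _ W(2)] Cons.prems(1) by auto
  obtain Vs' where Vs': "list_all2 bigstep (drop ?k Ns) Vs'" "Ws' = fill_list (map emb Cs) Vs'"
    using Cons.IH(2)[OF _ W(3)] Cons.prems(1) by auto
  have "length Vs = ?k" using Vs(1) Cons.prems(1) by (auto dest: list_all2_lengthD)
  then have "Ws = fill_list (map emb (C # Cs)) (Vs @ Vs')" using W Vs Vs' by simp
  moreover have "list_all2 bigstep Ns (Vs @ Vs')"
    using list_all2_appendI[OF Vs(1) Vs'(1)] by simp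
  ultimately show ?case by blast
qed

lemma bigsteps_fill_refl:
  fixes C :: "'a ctxt" and Cs :: "'a ctxt list"
  shows "length Ns = hn C \<Longrightarrow> bigsteps (fill (emb C) (map NT Ns)) (fill (emb C) (map NT Ns))"
    and "length Ns = sum_list (map hn Cs) \<Longrightarrow>
      list_all2 bigsteps (fill_list (map emb Cs) (map NT Ns)) (fill_list (map emb Cs) (map NT Ns))"
proof (induction C and Cs arbitrary: Ns and Ns rule: ctxt_pair_induct)
  case Hole
  then show ?case by (cases Ns) (auto intro: bigsteps_NT bigstep_NT)
next
  case (Node a Cs)
  then show ?case by (auto intro: bigsteps_Node)
next
  case (Cons C Cs)
  then show ?case by (simp add: take_map drop_map)
qed auto

text \<open>Prepending a step: a sequence is absorbed from its end backwards, and the order of its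
  independent steps disappears.\<close>

lemma step_bigsteps: "step G U U' \<Longrightarrow> bigsteps U' V \<Longrightarrow> bigsteps U V"
proof (induction arbitrary: V rule: step.induct)
  case (step_root N C Ns)
  then obtain Vs where "list_all2 bigstep Ns Vs" "V = fill (emb C) Vs"
    using bigsteps_fillD(1) rulesD(3) by blast
  with step_root.hyps show ?case by (auto intro: bigsteps_NT bigstep_rule)
next
  case (step_child T T' a Ts Us)
  from step_child.prems obtain Ws where W: "V = Node (Inl a) Ws" "list_all2 bigsteps (Ts @ T' # Us) Ws"
    by (auto elim: bigsteps_Node_E)
  then obtain As B Bs where "Ws = As @ B # Bs" "list_all2 bigsteps Ts As" "bigsteps T' B"
    "list_all2 bigsteps Us Bs"
    by (auto simp: list_all2_append1 list_all2_Cons1)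
  with step_child.IH[of B] W(1) show ?case
    by (auto intro!: bigsteps_Node list_all2_appendI)
qed

text \<open>The target has a shape that covers trees, with \<open>Ns = []\<close>, and derived
  contexts, with a single nonterminal.\<close>

lemma steps_bigstep:
  assumes "(step G)\<^sup>*\<^sup>* (NT N) (fill (emb C) (map NT Ns))" "length Ns = hn C"
  shows "bigstep N (fill (emb C) (map NT Ns))"
proof -
  have "bigsteps U (fill (emb C) (map NT Ns))"
    if "(step G)\<^sup>*\<^sup>* U (fill (emb C) (map NT Ns))" for U
    using that
  proof (induction rule: converse_rtranclp_induct)
    case base
    show ?case by (rule bigsteps_fill_refl(1)[OF assms(2)])
  next
    case (step U U')
    then show ?case using step_bigsteps by blast
  qed
  with assms(1) show ?thesis by (auto elim: bigsteps_NT_E)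
qed

lemma list_all2_derivations:
  "list_all2 (\<lambda>N V. \<exists>t. valid t \<and> root t = N \<and> (\<forall>X. yield t = nsub X V)) Ns Vs \<Longrightarrow>
    \<exists>ts. map root ts = Ns \<and> list_all valid ts \<and> (\<forall>X. map yield ts = map (nsub X) Vs)"
proof (induction rule: list_all2_induct)
  case (Cons N Ns V Vs)
  then obtain t ts where "valid t \<and> root t = N \<and> (\<forall>X. yield t = nsub X V)"
    "map root ts = Ns \<and> list_all valid ts \<and> (\<forall>X. map yield ts = map (nsub X) Vs)" by blast
  then show ?case by (intro exI[of _ "t # ts"]) simp
qed auto

text \<open>Without nonterminals \<open>nsub X V\<close> does not depend on \<open>X\<close>. Having
  this for all \<open>X\<close> keeps side trees fixed in \<open>bigstep_zipper\<close>, where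
  \<open>X\<close> varies with the plugged derivation.\<close>

lemma bigstep_tree:
  "bigstep N V \<Longrightarrow> ntlist V = [] \<Longrightarrow> \<exists>t. valid t \<and> root t = N \<and> (\<forall>X. yield t = nsub X V)"
proof (induction rule: bigstep.induct)
  case (bigstep_rule N C Ns Vs)
  have len: "length Vs = hn C"
    using bigstep_rule.IH rulesD(3)[OF bigstep_rule.hyps(1)] by (auto dest: list_all2_lengthD)
  then have "ntlist V = []" if "V \<in> set Vs" for V
    using bigstep_rule.prems that by (simp add: ntlist_fill(1))
  with bigstep_rule.IH have "list_all2 (\<lambda>N V. \<exists>t. valid t \<and> root t = N \<and> (\<forall>X. yield t = nsub X V)) Ns Vs"
    by (auto elim!: list_all2_mono simp: list_all2_conv_all_nth)
  from list_all2_derivations[OF this] obtain ts where ts: "map root ts = Ns" "list_all valid ts"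
    "\<forall>X. map yield ts = map (nsub X) Vs" by blast
  then show ?case using bigstep_rule.hyps(1) len
    by (intro exI[of _ "Der (N, C, Ns) ts"]) (auto simp: nsub_fill(1))
qed auto

lemma concat_eq_singletonD:
  "concat xss = [x] \<Longrightarrow> \<exists>ls rs. xss = ls @ [x] # rs \<and> concat ls = [] \<and> concat rs = []"
proof (induction xss)
  case (Cons xs xss)
  show ?case
  proof (cases xs)
    case Nil
    with Cons obtain ls rs where "xss = ls @ [x] # rs" "concat ls = []" "concat rs = []" by auto
    with Nil show ?thesis by (intro exI[of _ "xs # ls"] exI[of _ rs]) auto
  next
    case (Cons y ys)
    with Cons.prems show ?thesis by (intro exI[of _ "[]"] exI[of _ xss]) auto
  qed
qed auto

lemma bigstep_trees:
  assumes "list_all2 bigstep Ns Vs" "concat (map ntlist Vs) = []"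
  shows "\<exists>ts. map root ts = Ns \<and> list_all valid ts \<and> (\<forall>X. map yield ts = map (nsub X) Vs)"
  using assms bigstep_tree by (intro list_all2_derivations) (simp add: list_all2_conv_all_nth)

text \<open>The path to the only remaining nonterminal becomes the zipper; everything beside it is
  fully derived.\<close>

lemma bigstep_zipper:
  "bigstep N V \<Longrightarrow> ntlist V = [P] \<Longrightarrow> \<exists>Z. zok N P Z \<and> (\<forall>t. yield (plug Z t) = nsub (yield t) V)"
proof (induction rule: bigstep.induct)
  case (bigstep_NT N)
  then show ?case by (intro exI[of _ "[]"]) (simp add: zok_Nil)
next
  case (bigstep_rule N C Ns Vs)
  let ?Q = "\<lambda>N V. bigstep N V \<and> (ntlist V = [P] \<longrightarrow> (\<exists>Z. zok N P Z \<and> (\<forall>t. yield (plug Z t) = nsub (yield t) V)))"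
  have all: "list_all2 ?Q Ns Vs" using bigstep_rule.IH .
  have len: "length Vs = hn C"
    using all rulesD(3)[OF bigstep_rule.hyps(1)] by (auto dest: list_all2_lengthD)
  then have "concat (map ntlist Vs) = [P]" using bigstep_rule.prems by (simp add: ntlist_fill(1))
  from concat_eq_singletonD[OF this] obtain Ls V Rs where Vs: "Vs = Ls @ V # Rs"
    "concat (map ntlist Ls) = []" "ntlist V = [P]" "concat (map ntlist Rs) = []"
    by (auto simp: map_eq_append_conv map_eq_Cons_conv)
  from all obtain NL M NR where Ns: "Ns = NL @ M # NR" "list_all2 ?Q NL Ls" "?Q M V" "list_all2 ?Q NR Rs"
    unfolding Vs(1) by (auto simp: list_all2_append2 list_all2_Cons2)
  obtain ls where ls: "map root ls = NL" "list_all valid ls" "\<And>X. map yield ls = map (nsub X) Ls"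
    using bigstep_trees[OF list_all2_mono[OF Ns(2)] Vs(2)] by blast
  obtain rs where rs: "map root rs = NR" "list_all valid rs" "\<And>X. map yield rs = map (nsub X) Rs"
    using bigstep_trees[OF list_all2_mono[OF Ns(4)] Vs(4)] by blast
  obtain Z where Z: "zok M P Z" "\<And>t. yield (plug Z t) = nsub (yield t) V" using Ns(3) Vs(3) by blast
  let ?Z = "((N, C, Ns), ls, rs) # Z"
  have "zok N P ?Z"
    using zokD[OF Z(1)] bigstep_rule.hyps(1) ls rs Ns(1) unfolding zok_def by simp
  moreover have "yield (plug ?Z t) = nsub (yield t) (fill (emb C) Vs)" for t
    using Z(2)[of t] ls(3)[of "yield t"] rs(3)[of "yield t"] len by (simp add: nsub_fill(1) Vs(1))
  ultimately show ?case by blast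
qed

section \<open>Languages and subcontexts in terms of derivations and zippers\<close>

lemma lang_eq:
  assumes "N \<in> nonterms G"
  shows "lang G N = yield ` {t. valid t \<and> root t = N}"
proof
  show "lang G N \<subseteq> yield ` {t. valid t \<and> root t = N}"
  proof
    fix T assume "T \<in> lang G N"
    then have T: "hn T = 0" "(step G)\<^sup>*\<^sup>* (NT N) (emb T)" by (auto simp: lang_def trees_def)
    then have "bigstep N (emb T)"
      using steps_bigstep[of N T "[]"] by (simp add: fill_Nil)
    moreover have "ntlist (emb T :: ('a + 'n) ctxt) = []"
      using ntlist_fill(1)[of "[]" T] T(1) by (simp add: fill_Nil)
    ultimately obtain t where t: "valid t" "root t = N" "yield t = nsub T (emb T :: ('a + 'n) ctxt)"
      using bigstep_tree by blast
    moreover have "nsub T (emb T :: ('a + 'n) ctxt) = T"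
      using nsub_fill(1)[of "[]" T T] T(1) by (simp add: fill_Nil)
    ultimately show "T \<in> yield ` {t. valid t \<and> root t = N}" by force
  qed
  have "leftmost_step G T U \<Longrightarrow> step G T U" for T U
    by (induction rule: leftmost_step.induct) (auto intro: step.intros)
  then have "leftmost_step G \<le> step G" by blast
  from rtranclp_mono[OF this] show "yield ` {t. valid t \<and> root t = N} \<subseteq> lang G N"
    using leftmost_steps_yield yield_in_trees by (auto simp: lang_def)
qed

lemma ctxt_lang_zipper:
  assumes "S \<in> ctxt_lang G P Q"
  shows "\<exists>Z. zok Q P Z \<and> (\<forall>t. yield (plug Z t) = fill S [yield t])"
proof -
  have S: "hn S = 1" "(step G)\<^sup>*\<^sup>* (NT Q) (fill (emb S) (map NT [P]))"
    using assms by (auto simp: ctxt_lang_def linear_contexts_def)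
  have len: "length (map NT [P]) = hn S" using S(1) by simp
  have "bigstep Q (fill (emb S) (map NT [P]))" using S by (intro steps_bigstep) auto
  moreover have "ntlist (fill (emb S) (map NT [P])) = [P]" unfolding ntlist_fill(1)[OF len] by simp
  ultimately obtain Z where "zok Q P Z" "\<forall>t. yield (plug Z t) = nsub (yield t) (fill (emb S) (map NT [P]))"
    using bigstep_zipper by blast
  moreover have "nsub X (fill (emb S) (map NT [P])) = fill S [X]" for X
    unfolding nsub_fill(1)[OF len] by simp
  ultimately show ?thesis by auto
qed

lemma zipper_context:
  "valid (plug E t) \<Longrightarrow>
    \<exists>C. is_context (terminals G) C \<and> hn C = 1 \<and> yield (plug E t) = fill C [yield t]"
proof (induction E)
  case Nil
  show ?case by (intro exI[of _ Hole]) simp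
next
  case (Cons f E)
  obtain N C Ns ls rs where f: "f = ((N, C, Ns), ls, rs)" by (metis surj_pair)
  have v: "valid (plug E t)" "list_all valid (ls @ rs)" "(N, C, Ns) \<in> rules G"
    using Cons.prems f by auto
  obtain D where D: "is_context (terminals G) D" "hn D = 1" "yield (plug E t) = fill D [yield t]"
    using Cons.IH v(1) by blast
  let ?As = "map yield ls" and ?Bs = "map yield rs"
  have trees: "is_context (terminals G) (yield u) \<and> hn (yield u) = 0" if "u \<in> set (ls @ rs)" for u
    using v(2) yield_tree that by (auto simp: list_all_iff)
  have hn: "sum_list (map hn ?As) = 0" "sum_list (map hn ?Bs) = 0" using trees by auto
  have len: "length (?As @ D # ?Bs) = hn C"
    using valid_length[of N C Ns "ls @ plug E t # rs"] Cons.prems f by simp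
  have "yield (plug (f # E) t) = fill C (?As @ fill D [yield t] # ?Bs)" by (simp add: f D(3))
  also have "\<dots> = fill C (fill_list (?As @ D # ?Bs) [yield t])"
    using fill_list_one_hole[OF hn(1) D(2) hn(2)] by simp
  also have "\<dots> = fill (fill C (?As @ D # ?Bs)) [yield t]"
    using hn D(2) by (intro fill_fill(1)[symmetric] len) simp
  finally have "yield (plug (f # E) t) = fill (fill C (?As @ D # ?Bs)) [yield t]" .
  moreover have "hn (fill C (?As @ D # ?Bs)) = 1" using hn_fill(1)[OF len] hn D(2) by simp
  moreover have "is_context (terminals G) (fill C (?As @ D # ?Bs))"
    using rulesD(2)[OF v(3)] len trees D(1) by (intro is_context_fill(1)) (auto simp: list_all_iff)
  ultimately show ?case by blast
qed

text \<open>The zipper above the occurrence yields the surrounding context with a single hole, and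
  the derivation below yields the tree that fills \<open>S\<close>.\<close>

lemma contains_subcontext:
  assumes "valid D" "contains Z D" "hn S = 1" "\<And>t. yield (plug Z t) = fill S [yield t]"
  shows "subcontext (terminals G) S (yield D)"
proof -
  obtain E u where D: "D = plug E (plug Z u)" using assms(2) unfolding contains_def by blast
  then have "valid u" using assms(1) valid_plugD by blast
  then have u: "is_context (terminals G) (yield u)" using yield_tree by blast
  obtain C where C: "is_context (terminals G) C" "hn C = 1" "yield D = fill C [fill S [yield u]]"
    using zipper_context[of E "plug Z u"] assms D by metis
  show ?thesis unfolding subcontext_def
  proof (intro bexI exI conjI)
    show "yield D = fill_at C 1 (fill S [yield u])" using C(2,3) by (simp add: fill_at_def)
  qed (use C u assms(3) in \<open>auto simp: contexts_def\<close>)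
qed

lemma connected:
  assumes "unambiguous G" "strongly_connected G" "infinite (lang_all G)"
  shows "connected_rules (rules G) fst (\<lambda>\<rho>. snd (snd \<rho>)) (\<lambda>\<rho>. csize (fst (snd \<rho>))) (nonterms G)"
proof unfold_locales
  show "finite (rules G)" "finite (nonterms G)" using regular by (auto simp: regular_tree_grammar_def)
  show "fst \<rho> \<in> nonterms G" if "\<rho> \<in> rules G" for \<rho> using that rulesD(1) by (cases \<rho>) auto
  show "\<exists>\<Gamma>. \<forall>n. finite {t. valid t \<and> dsize t = n} \<and> card {t. valid t \<and> dsize t = n} \<le> \<Gamma> ^ Suc n"
    by (rule growth) (rule yield_inject[OF assms(1)])
  show "\<exists>Z. zok M N Z" if "M \<in> nonterms G" "N \<in> nonterms G" for M N
    using assms(2) that ctxt_lang_zipper unfolding strongly_connected_def by blast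
  show "infinite {t. valid t}"
  proof
    assume "finite {t. valid t}"
    moreover have "lang_all G \<subseteq> yield ` {t. valid t}" using lang_eq by (auto simp: lang_all_def)
    ultimately show False using assms(3) finite_subset by blast
  qed
qed

end

section \<open>Passing to the limit and assembling the result\<close>

lemma limdef_one_minus:
  fixes T b g :: "nat \<Rightarrow> nat"
  assumes "infinite {n. T n \<noteq> 0}" "(\<lambda>n. real (b n) / real (T n)) \<longlonglongrightarrow> 0"
    and "\<And>n. T n \<le> g n + b n" "\<And>n. g n \<le> T n"
  shows "has_limdef (\<lambda>n. real (g n)) (\<lambda>n. real (T n)) 1"
proof -
  let ?A = "{n. real (T n) \<noteq> 0}"
  have inf: "infinite ?A" using assms(1) by simp
  let ?e = "enumerate ?A"
  have "strict_mono ?e" using inf by (rule strict_mono_enumerate)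
  then have lim: "(\<lambda>j. real (b (?e j)) / real (T (?e j))) \<longlonglongrightarrow> 0"
    using LIMSEQ_subseq_LIMSEQ[OF assms(2)] by (simp add: comp_def)
  have "(\<lambda>j. real (g (?e j)) / real (T (?e j))) \<longlonglongrightarrow> 1"
  proof (rule tendsto_sandwich[OF always_eventually always_eventually])
    show "\<forall>j. 1 - real (b (?e j)) / real (T (?e j)) \<le> real (g (?e j)) / real (T (?e j))"
    proof
      fix j
      have "0 < T (?e j)" using enumerate_in_set[OF inf, of j] by simp
      moreover have "real (T (?e j)) \<le> real (g (?e j)) + real (b (?e j))"
        using assms(3)[of "?e j"] by linarith
      ultimately have "1 \<le> (real (g (?e j)) + real (b (?e j))) / real (T (?e j))"
        by (simp add: le_divide_eq_1)
      then show "1 - real (b (?e j)) / real (T (?e j)) \<le> real (g (?e j)) / real (T (?e j))"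
        unfolding add_divide_distrib by linarith
    qed
    show "\<forall>j. real (g (?e j)) / real (T (?e j)) \<le> 1"
      using assms(4) by (auto simp: divide_le_eq_1)
    show "(\<lambda>j. 1 - real (b (?e j)) / real (T (?e j))) \<longlonglongrightarrow> 1"
      using tendsto_diff[OF tendsto_const lim, of 1] by simp
  qed simp
  with inf show ?thesis by (simp add: has_limdef_def)
qed

theorem theorem2p13:
  fixes G :: "('a, 'n) grammar" and S :: "nat \<Rightarrow> 'a ctxt"
  assumes "regular_tree_grammar G"
    and "unambiguous G"
    and "strongly_connected G"
    and "infinite (lang_all G)"
    and "\<forall>n. S n \<in> ctxt_lang_all G"
    and "(\<lambda>n. real (csize (S n))) \<in> O(\<lambda>n. real n)"
  shows "\<exists>p::real. p > 0 \<and> (\<forall>N \<in> nonterms G.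
    has_limdef
      (\<lambda>n. real (card {T \<in> lang_size G n N.
                     subcontext (terminals G) (S (nat \<lceil>p * log 2 (real n)\<rceil>)) T}))
      (\<lambda>n. real (card (lang_size G n N)))
      1)"
proof -
  interpret tree_grammar G by unfold_locales (rule assms(1))
  interpret connected_rules "rules G" fst "\<lambda>\<rho>. snd (snd \<rho>)" "\<lambda>\<rho>. csize (fst (snd \<rho>))" "nonterms G"
    by (rule connected[OF assms(2-4)])
  obtain \<Theta> where \<Theta>: "2 \<le> \<Theta>" and bound: "\<And>Q P Z N n. Q \<in> nonterms G \<Longrightarrow> P \<in> nonterms G \<Longrightarrow> zok Q P Z \<Longrightarrow>
      card {t. valid t \<and> root t = N \<and> dsize t = n \<and> \<not> contains Z t} * n \<le>
      card {t. valid t \<and> root t = N \<and> dsize t = n} * \<Theta> ^ Suc (zsize Z)"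
    using not_containing_le by blast
  have "\<exists>P Q Z. P \<in> nonterms G \<and> Q \<in> nonterms G \<and> zok Q P Z \<and> hn (S m) = 1 \<and>
      (\<forall>t. yield (plug Z t) = fill (S m) [yield t])" for m
    using assms(5) ctxt_lang_zipper
    by (fastforce simp: ctxt_lang_all_def ctxt_lang_def linear_contexts_def)
  then obtain P Q Z where Z: "\<And>m. P m \<in> nonterms G" "\<And>m. Q m \<in> nonterms G"
    "\<And>m. zok (Q m) (P m) (Z m)" "\<And>m. hn (S m) = 1" "\<And>m t. yield (plug (Z m) t) = fill (S m) [yield t]"
    by metis
  \<comment> \<open>\<open>Z m\<close> is tied to \<open>S m\<close> only through yields, so the two
    sizes are compared after plugging in some derivation with root \<open>P m\<close>.\<close>
  have zsize: "zsize (Z m) = csize (S m)" for m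
  proof -
    obtain t where t: "valid t" "root t = P m" using inhabited Z(1) by blast
    then have "zsize (Z m) + dsize t = csize (yield (plug (Z m) t))"
      using zokD(1)[OF Z(3)] yield_tree dsize_plug by metis
    also have "\<dots> = csize (S m) + dsize t"
      using csize_fill(1)[of "[yield t]" "S m"] Z(4) t yield_tree by (simp add: Z(5))
    finally show ?thesis by simp
  qed
  obtain c' where "eventually (\<lambda>n. norm (real (csize (S n))) \<le> c' * norm (real n)) sequentially"
    using landau_o.bigE[OF assms(6)] by blast
  moreover define c where "c = Suc (nat \<lceil>c'\<rceil>)"
  have "csize (S n) \<le> c * n" if "norm (real (csize (S n))) \<le> c' * norm (real n)" for n
  proof -
    have "c' \<le> real c" unfolding c_def by linarith
    then have "c' * real n \<le> real c * real n" by (rule mult_right_mono) simp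
    with that have "real (csize (S n)) \<le> real (c * n)" by simp
    then show ?thesis by (simp only: of_nat_le_iff)
  qed
  ultimately have c: "eventually (\<lambda>m. zsize (Z m) \<le> c * m) sequentially"
    by (auto elim: eventually_mono simp: zsize)
  \<comment> \<open>Only \<Theta> and the slope \<open>c\<close> enter, so \<open>p\<close> is fixed
    before the nonterminal \<open>N\<close> is chosen.\<close>
  define p where "p = 1 / (2 * real c * log 2 (real \<Theta>))"
  have "0 < p" using \<Theta> by (simp add: p_def c_def)
  moreover have "has_limdef
      (\<lambda>n. real (card {T \<in> lang_size G n N. subcontext (terminals G) (S (nat \<lceil>p * log 2 (real n)\<rceil>)) T}))
      (\<lambda>n. real (card (lang_size G n N))) 1"
    if N: "N \<in> nonterms G" for N
  proof -
    define D where "D n = {t. valid t \<and> root t = N \<and> dsize t = n}" for n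
    define W where "W n = Z (nat \<lceil>p * log 2 (real n)\<rceil>)" for n
    define bad where "bad n = {t. valid t \<and> root t = N \<and> dsize t = n \<and> \<not> contains (W n) t}" for n
    define good where
      "good n = {T \<in> lang_size G n N. subcontext (terminals G) (S (nat \<lceil>p * log 2 (real n)\<rceil>)) T}" for n
    have fin: "finite (D n)" for n
      by (rule finite_subset[OF _ finite_dsize_le[of n]]) (auto simp: D_def)
    have L: "lang_size G n N = yield ` D n" for n
      unfolding lang_size_def lang_eq[OF N] D_def using yield_tree by auto
    have "inj_on yield (D n)" for n
      by (rule inj_onI) (use yield_inject[OF assms(2)] in \<open>auto simp: D_def\<close>)
    then have cardL: "card (lang_size G n N) = card (D n)" for n by (simp add: L card_image)
    have finL: "finite (lang_size G n N)" for n by (simp add: L fin)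
    have "(\<lambda>n. real (card (bad n)) / real (card (D n))) \<longlonglongrightarrow> 0"
    proof (rule logarithmic_exponent_tendsto_0[OF \<Theta> _ p_def c])
      show "0 < c" by (simp add: c_def)
      show "card (bad n) * n \<le> card (D n) * \<Theta> ^ Suc (zsize (Z (nat \<lceil>p * log 2 (real n)\<rceil>)))" for n
        unfolding bad_def D_def W_def by (rule bound) (rule Z)+
    qed
    moreover have "{n. card (D n) \<noteq> 0} = {n. \<exists>t. valid t \<and> root t = N \<and> dsize t = n}"
      using fin by (auto simp: D_def)
    then have "infinite {n. card (D n) \<noteq> 0}" using infinite_sizes[OF N] by simp
    moreover have "card (D n) \<le> card (good n) + card (bad n)" for n
    proof -
      have "yield ` D n \<subseteq> good n \<union> yield ` bad n"
      proof
        fix T assume "T \<in> yield ` D n"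
        then obtain t where t: "t \<in> D n" "T = yield t" by blast
        show "T \<in> good n \<union> yield ` bad n"
        proof (cases "contains (W n) t")
          case True
          then have "subcontext (terminals G) (S (nat \<lceil>p * log 2 (real n)\<rceil>)) T"
            using t Z(4,5) unfolding W_def D_def by (auto intro!: contains_subcontext)
          with t show ?thesis by (auto simp: good_def L)
        next
          case False
          with t show ?thesis by (auto simp: bad_def D_def)
        qed
      qed
      moreover have finbad: "finite (bad n)"
        by (rule finite_subset[OF _ fin[of n]]) (auto simp: bad_def D_def)
      moreover have "finite (good n)" using finL by (simp add: good_def)
      ultimately have "card (yield ` D n) \<le> card (good n \<union> yield ` bad n)"
        by (intro card_mono) auto
      also have "\<dots> \<le> card (good n) + card (yield ` bad n)" by (rule card_Un_le)
      also have "\<dots> \<le> card (good n) + card (bad n)" using finbad by (simp add: card_image_le)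
      finally show ?thesis using cardL L by simp
    qed
    moreover have "card (good n) \<le> card (D n)" for n
      unfolding cardL[symmetric] good_def using finL by (intro card_mono) auto
    ultimately show ?thesis
      unfolding cardL good_def[symmetric] by (intro limdef_one_minus)
  qed
  ultimately show ?thesis by blast
qed

end
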